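(* Let $N\ge 6$, let $\lambda\in(0,1)$, let $(\hat S,\hat A,\hat P,\hat r)$ be the auxiliary MDP described in the context, and let $\lambda_c=15/17$. For $k=1,2$ and $(i,j)\in\hat S\setminus\{(0,0)\}$ define the set of actions $A^*_k(i,j)$ by: - $A^*_k(N,N)=\{0\}$ for $k=1,2$; - $A^*_k(N,j)=\{a_{11}\}$ if $j=N-2$ or $j=N-4$, for $k=1,2$; - $A^*_k(i,N)=\{a_{21}\}$ if $i=N-2$ or $i=N-4$, for $k=1,2$; - $A^*_k(N,N-3)=\{a_{12}\}$ for $k=1,2$; - $A^*_k(N-3,N)=\{a_{22}\}$ for $k=1,2$; - $A^*_1(N,j)=\{a_{11}\}$ and $A^*_2(N,j)=\{a_{12}\}$ if $j=2,\ldots,N-5$; - $A^*_1(i,N)=\{a_{21}\}$ and $A^*_2(i,N)=\{a_{22}\}$ if $i=2,\ldots,N-5$; - $A^*_k(N-2,N-3)=\{a_{12}\}$ for $k=1,2$; - $A^*_k(N-3,N-2)=\{a_{22}\}$ for $k=1,2$; - $A^*_k(N-2,j)=A^*_k(j,N-2)=\{a_0\}$ if $j=2,\ldots,N-4$ or $j=N-2$, for $k=1,2$; - $A^*_k(N-3,N-3)=\{a_{12},a_{22}\}$ for $k=1,2$; - $A^*_k(N-3,j)=A^*_k(j,N-3)=\{a_0\}$ if $j=2,\ldots,N-4$, for $k=1,2$; - $A^*_k(i,j)=\{a_0\}$ if $i,j=2,\ldots,N-4$, for $k=1,2$. Then a stationary deterministic policy $\pi^*=(d^* )^\infty$ is optimal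 in the auxiliary MDP with discount factor $\lambda$ if and only if, for all $(i,j)\in\hat S\setminus\{(0,0)\}$, $$d^*(i,j)\in\begin{cases}A^*_1(i,j),&\text{if }\lambda\in(\lambda_c,1),\\ A^*_1(i,j)\cup A^*_2(i,j),&\text{if }\lambda=\lambda_c,\\ A^*_2(i,j),&\text{if }\lambda\in(0,\lambda_c).\end{cases}$$
   Context: **Auxiliary MDP $(\hat S,\hat A,\hat P,\hat r)$.** Let $N\ge 6$ be an integer. State space: $\hat S=\{(i,j): i,j\in\{2,3,\ldots,N-2\}\cup\{N\}\}\cup\{(0,0)\}$. Actions are the symbols $a_{11},a_{12},a_{21},a_{22},a_{11}',a_{12}',a_{21}',a_{22}',a_0,\tilde a,0$. The set $\hat A(i,j)$ of actions available in state $(i,j)$ is: - $\{0\}$ if $i=j=0$ or $i=j=N$; - $\{a_{11}',a_{12}',a_{21}',a_{22}',a_0,\tilde a,0\}$ if $i=j=2$; - $\{a_{11}',a_{12}',a_{21},a_{22},a_{21}',a_{22}',a_0,\tilde a,0\}$ if $i=2$, $3\le j\le N-3$; - $\{a_{11}',a_{21},a_{22},a_{21}',a_{22}',a_0,\tilde a,0\}$ if $i=2$, $j=N-2$; - $\{a_{11},a_{12},a_{11}',a_{12}',a_{21}',a_{22}',a_0,\tilde a,0\}$ if $3\le i\le N-3$, $j=2$; - $\{a_{11},a_{12},a_{11}',a_{12}',a_{21}',a_0,\tilde a,0\}$ if $i=N-2$, $j=2$; - $\{a_{11},a_{12},a_{11}',a_{12}',a_{21},a_{22},a_{21}',a_{22}',a_0,\tilde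 a,0\}$ if $3\le i,j\le N-3$; - $\{a_{11},a_{12},a_{11}',a_{12}',a_{21},a_{21}',a_0,\tilde a,0\}$ if $i=N-2$, $3\le j\le N-3$; - $\{a_{11},a_{11}',a_{21},a_{22},a_{21}',a_{22}',a_0,\tilde a,0\}$ if $3\le i\le N-3$, $j=N-2$; - $\{a_{11},a_{11}',a_{21},a_{21}',a_0,\tilde a,0\}$ if $i=j=N-2$; - $\{a_{21},0\}$ if $i=N-2$, $j=N$; - $\{a_{11},a_{12},0\}$ if $i=N$, $2\le j\le N-3$; - $\{a_{11},0\}$ if $i=N$, $j=N-2$; - $\{a_{21},a_{22},0\}$ if $2\le i\le N-3$, $j=N$. Transition kernel $\hat P(\cdot\mid(i,j),a)$ (next states not listed have probability $0$): - $a_{11}$, $i\in\{3,\ldots,N-2,N\}$: if $2\le j\le N-3$, to $(i,j)$ w.p. $1/3$, $(i,j+1)$ w.p. $2/3$; if $j=N-2$, to $(i,N-2)$ w.p. $1/4$, $(i,N)$ w.p. $3/4$. - $a_{12}$, $i\in\{3,\ldots,N-2,N\}$: if $2\le j\le N-4$, to $(i,j)$ w.p. $5/9$, $(i,j+1)$ w.p. $7/27$, $(i,j+2)$ w.p. $5/27$; if $j=N-3$, to $(i,N-3)$ w.p. $7/18$, $(i,N-2)$ w.p. $31/144$, $(i,N)$ w.p. $19/48$. - $a_{11}'$, $2\le i\le N-2$: if $2\le j\le N-3$, to $(i,j)$ w.p. $1/2$, $(i,j+1)$ w.p. $1/2$; if $j=N-2$, to $(i,N-2)$ w.p. $1/3$,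 $(i,N)$ w.p. $2/3$. - $a_{12}'$, $2\le i\le N-2$: if $2\le j\le N-4$, to $(i,j)$ w.p. $5/8$, $(i,j+1)$ w.p. $1/4$, $(i,j+2)$ w.p. $1/8$; if $j=N-3$, to $(i,N-3)$ w.p. $4/9$, $(i,N-2)$ w.p. $5/27$, $(i,N)$ w.p. $10/27$. - $a_{21},a_{22},a_{21}',a_{22}'$: by exchanging coordinates, $\hat P((i',j')\mid(i,j),a_{2\ell})=\hat P((j',i')\mid(j,i),a_{1\ell})$ and $\hat P((i',j')\mid(i,j),a_{2\ell}')=\hat P((j',i')\mid(j,i),a_{1\ell}')$, $\ell=1,2$. - $a_0$: if $2\le i,j\le N-3$, to $(i,j)$ w.p. $4/9$, $(i+1,j)$ w.p. $1/9$, $(i,j+1)$ w.p. $1/9$, $(i+1,j+1)$ w.p. $1/3$; if $2\le i\le N-3$, $j=N-2$, to $(i,N-2)$ w.p. $5/12$, $(i,N)$ w.p. $1/8$, $(i+1,N-2)$ w.p. $1/9$, $(i+1,N)$ w.p. $25/72$; if $i=N-2$, $2\le j\le N-3$, to $(N-2,j)$ w.p. $5/12$, $(N,j)$ w.p. $1/8$, $(N-2,j+1)$ w.p. $1/9$, $(N,j+1)$ w.p. $25/72$; if $i=j=N-2$, to $(N-2,N-2)$ w.p. $7/18$, $(N,N-2)$ w.p. $1/8$, $(N-2,N)$ w.p. $1/8$, $(N,N)$ w.p. $13/36$. - $\tilde a$: if $3\le i,j\le N-2$, to $(i,j)$ w.p. $1$; if $i=2$, $3\le j\le N-2$, to $(2,j)$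 and $(2,j-1)$ w.p. $1/2$ each; if $3\le i\le N-2$, $j=2$, to $(i,2)$ and $(i-1,2)$ w.p. $1/2$ each; if $i=j=2$, to $(2,2)$ w.p. $1/3$, $(0,0)$ w.p. $2/3$. - $0$: to $(i,j)$ w.p. $1$, for every $(i,j)\in\hat S$. Reward: $\hat r(s,a)=1$ if $s=(N,N)$ and $\hat r(s,a)=0$ otherwise. **Policies and optimality.** A stationary deterministic policy $\pi=d^\infty$ applies at every time $t=0,1,2,\ldots$ a decision rule $d$ with $d(s)\in\hat A(s)$ for all $s\in\hat S$. Its value function is $v^\pi_\lambda(s)=\mathbb E^\pi_s[\sum_{t\ge0}\lambda^t\hat r(X_t,Y_t)]$, where $X_t$ is the state and $Y_t=d(X_t)$ the action at time $t$, and $X_0=s$. A stationary deterministic policy $\pi^*$ is optimal if $v^{\pi^*}_\lambda(s)\ge v^\pi_\lambda(s)$ for all $s\in\hat S$ and all stationary deterministic policies $\pi$. *)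

theory Defs
  imports "HOL-Probability.Probability"
begin

section \<open>Stationary deterministic policies in discounted Markov decision processes\<close>

text \<open>
  The law of the Markov chain \<open>X\<^sub>0, X\<^sub>1, \<dots>\<close> with \<open>X\<^sub>0 = s\<close> and transition probabilities \<open>K\<close>, as a
  measure on the product space of all trajectories \<open>\<omega>\<close> (with \<open>X\<^sub>t = \<omega> t\<close>), obtained from the
  Ionescu-Tulcea theorem: \<open>X\<^sub>0\<close> has the law \<open>chain_step K s 0\<close>, and \<open>chain_step K s t\<close> is the
  conditional law of \<open>X\<^sub>t\<close> given the history \<open>\<omega> 0, \<dots>, \<omega> (t - 1)\<close>.
\<close>

primrec chain_step :: "('s \<Rightarrow> 's pmf) \<Rightarrow> 's \<Rightarrow> nat \<Rightarrow> (nat \<Rightarrow> 's) \<Rightarrow> 's measure" where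
  "chain_step K s 0 = (\<lambda>\<omega>. measure_pmf (return_pmf s))"
| "chain_step K s (Suc t) = (\<lambda>\<omega>. measure_pmf (K (\<omega> t)))"

lemma Ionescu_Tulcea_chain_step:
  fixes K :: "'s \<Rightarrow> 's pmf"
  shows "Ionescu_Tulcea (chain_step K s) (\<lambda>_. count_space UNIV)"
proof (rule Ionescu_Tulcea.intro)
  fix i
  show "chain_step K s i \<in>
    measurable (PiM {0..<i} (\<lambda>_. count_space UNIV)) (subprob_algebra (count_space UNIV))"
  proof (cases i)
    case 0
    then show ?thesis by (simp add: measure_pmf_in_subprob_algebra)
  next
    case (Suc t)
    have "(\<lambda>\<omega>. \<omega> t) \<in> measurable (PiM {0..<i} (\<lambda>_. count_space (UNIV :: 's set))) (count_space UNIV)"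
      using Suc by (intro measurable_component_singleton) auto
    moreover have "(\<lambda>x. measure_pmf (K x)) \<in>
        measurable (count_space UNIV) (subprob_algebra (count_space UNIV))"
      by (simp add: measure_pmf_in_subprob_algebra)
    ultimately show ?thesis
      unfolding Suc chain_step.simps by (rule measurable_compose)
  qed
next
  fix i and x :: "nat \<Rightarrow> 's"
  show "prob_space (chain_step K s i x)"
    by (cases i) (auto intro: prob_space_measure_pmf)
qed

definition trajectories :: "('s \<Rightarrow> 's pmf) \<Rightarrow> 's \<Rightarrow> (nat \<Rightarrow> 's) measure" where
  "trajectories K s =
     projective_family.lim UNIV (Ionescu_Tulcea.CI (chain_step K s) (\<lambda>_. count_space UNIV))
       (\<lambda>_. count_space UNIV)"

definition decision_rule :: "'s set \<Rightarrow> ('s \<Rightarrow> 'a set) \<Rightarrow> ('s \<Rightarrow> 'a) \<Rightarrow> bool" where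
  "decision_rule S A d \<longleftrightarrow> (\<forall>s\<in>S. d s \<in> A s)"

definition policy_value ::
  "('s \<Rightarrow> 'a \<Rightarrow> 's pmf) \<Rightarrow> ('s \<Rightarrow> 'a \<Rightarrow> real) \<Rightarrow> real \<Rightarrow> ('s \<Rightarrow> 'a) \<Rightarrow> 's \<Rightarrow> real" where
  "policy_value P r lam d s =
     (\<integral>\<omega>. (\<Sum>t. lam ^ t * r (\<omega> t) (d (\<omega> t))) \<partial>trajectories (\<lambda>x. P x (d x)) s)"

definition optimal_policy ::
  "'s set \<Rightarrow> ('s \<Rightarrow> 'a set) \<Rightarrow> ('s \<Rightarrow> 'a \<Rightarrow> 's pmf) \<Rightarrow> ('s \<Rightarrow> 'a \<Rightarrow> real) \<Rightarrow> real \<Rightarrow> ('s \<Rightarrow> 'a) \<Rightarrow> bool" where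
  "optimal_policy S A P r lam d \<longleftrightarrow>
     (\<forall>s\<in>S. \<forall>d'. decision_rule S A d' \<longrightarrow> policy_value P r lam d s \<ge> policy_value P r lam d' s)"


section \<open>The auxiliary MDP\<close>

type_synonym state = "nat \<times> nat"

text \<open>\<open>Atilde\<close> is \<open>a\<close> with a tilde, and \<open>Null\<close> is the action written \<open>0\<close>.\<close>

datatype action = A11 | A12 | A21 | A22 | A11' | A12' | A21' | A22' | A0 | Atilde | Null

definition hat_S :: "nat \<Rightarrow> state set" where
  "hat_S N = {(i, j). i \<in> {2..N-2} \<union> {N} \<and> j \<in> {2..N-2} \<union> {N}} \<union> {(0, 0)}"

fun hat_A :: "nat \<Rightarrow> state \<Rightarrow> action set" where
  "hat_A N (i, j) =
    (if (i = 0 \<and> j = 0) \<or> (i = N \<and> j = N) then {Null}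
     else if i = 2 \<and> j = 2 then {A11', A12', A21', A22', A0, Atilde, Null}
     else if i = 2 \<and> j \<in> {3..N-3} then {A11', A12', A21, A22, A21', A22', A0, Atilde, Null}
     else if i = 2 \<and> j = N-2 then {A11', A21, A22, A21', A22', A0, Atilde, Null}
     else if i \<in> {3..N-3} \<and> j = 2 then {A11, A12, A11', A12', A21', A22', A0, Atilde, Null}
     else if i = N-2 \<and> j = 2 then {A11, A12, A11', A12', A21', A0, Atilde, Null}
     else if i \<in> {3..N-3} \<and> j \<in> {3..N-3}
       then {A11, A12, A11', A12', A21, A22, A21', A22', A0, Atilde, Null}
     else if i = N-2 \<and> j \<in> {3..N-3} then {A11, A12, A11', A12', A21, A21', A0, Atilde, Null}
     else if i \<in> {3..N-3} \<and> j = N-2 then {A11, A11', A21, A22, A21', A22', A0, Atilde, Null}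
     else if i = N-2 \<and> j = N-2 then {A11, A11', A21, A21', A0, Atilde, Null}
     else if i = N-2 \<and> j = N then {A21, Null}
     else if i = N \<and> j \<in> {2..N-3} then {A11, A12, Null}
     else if i = N \<and> j = N-2 then {A11, Null}
     else if i \<in> {2..N-3} \<and> j = N then {A21, A22, Null}
     else {})"

text \<open>
  Transition laws are lists of (next state, probability) pairs. The actions \<open>A1l\<close>, \<open>A1l'\<close> move only
  the second coordinate, with a law that depends only on that coordinate; \<open>A2l\<close>, \<open>A2l'\<close> do
  the same with the coordinates exchanged. Where an action is not available the law is never used;
  it is then either given by the same formula or set to the point mass at the current state.
\<close>

definition law_1 :: "nat \<Rightarrow> nat \<Rightarrow> (nat \<times> real) list" where
  "law_1 N j =
    (if 2 \<le> j \<and> j \<le> N-3 then [(j, 1/3), (j+1, 2/3)]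
     else if j = N-2 then [(N-2, 1/4), (N, 3/4)]
     else [(j, 1)])"

definition law_2 :: "nat \<Rightarrow> nat \<Rightarrow> (nat \<times> real) list" where
  "law_2 N j =
    (if 2 \<le> j \<and> j \<le> N-4 then [(j, 5/9), (j+1, 7/27), (j+2, 5/27)]
     else if j = N-3 then [(N-3, 7/18), (N-2, 31/144), (N, 19/48)]
     else [(j, 1)])"

definition law_1' :: "nat \<Rightarrow> nat \<Rightarrow> (nat \<times> real) list" where
  "law_1' N j =
    (if 2 \<le> j \<and> j \<le> N-3 then [(j, 1/2), (j+1, 1/2)]
     else if j = N-2 then [(N-2, 1/3), (N, 2/3)]
     else [(j, 1)])"

definition law_2' :: "nat \<Rightarrow> nat \<Rightarrow> (nat \<times> real) list" where
  "law_2' N j =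
    (if 2 \<le> j \<and> j \<le> N-4 then [(j, 5/8), (j+1, 1/4), (j+2, 1/8)]
     else if j = N-3 then [(N-3, 4/9), (N-2, 5/27), (N, 10/27)]
     else [(j, 1)])"

definition move_snd :: "nat \<Rightarrow> (nat \<times> real) list \<Rightarrow> (state \<times> real) list" where
  "move_snd i xs = map (\<lambda>(j', p). ((i, j'), p)) xs"

definition move_fst :: "nat \<Rightarrow> (nat \<times> real) list \<Rightarrow> (state \<times> real) list" where
  "move_fst j xs = map (\<lambda>(i', p). ((i', j), p)) xs"

fun hat_law :: "nat \<Rightarrow> state \<Rightarrow> action \<Rightarrow> (state \<times> real) list" where
  "hat_law N (i, j) A11 = move_snd i (law_1 N j)"
| "hat_law N (i, j) A12 = move_snd i (law_2 N j)"
| "hat_law N (i, j) A11' = move_snd i (law_1' N j)"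
| "hat_law N (i, j) A12' = move_snd i (law_2' N j)"
| "hat_law N (i, j) A21 = move_fst j (law_1 N i)"
| "hat_law N (i, j) A22 = move_fst j (law_2 N i)"
| "hat_law N (i, j) A21' = move_fst j (law_1' N i)"
| "hat_law N (i, j) A22' = move_fst j (law_2' N i)"
| "hat_law N (i, j) A0 =
    (if i \<in> {2..N-3} \<and> j \<in> {2..N-3}
       then [((i, j), 4/9), ((i+1, j), 1/9), ((i, j+1), 1/9), ((i+1, j+1), 1/3)]
     else if i \<in> {2..N-3} \<and> j = N-2
       then [((i, N-2), 5/12), ((i, N), 1/8), ((i+1, N-2), 1/9), ((i+1, N), 25/72)]
     else if i = N-2 \<and> j \<in> {2..N-3}
       then [((N-2, j), 5/12), ((N, j), 1/8), ((N-2, j+1), 1/9), ((N, j+1), 25/72)]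
     else if i = N-2 \<and> j = N-2
       then [((N-2, N-2), 7/18), ((N, N-2), 1/8), ((N-2, N), 1/8), ((N, N), 13/36)]
     else [((i, j), 1)])"
| "hat_law N (i, j) Atilde =
    (if i \<in> {3..N-2} \<and> j \<in> {3..N-2} then [((i, j), 1)]
     else if i = 2 \<and> j \<in> {3..N-2} then [((2, j), 1/2), ((2, j-1), 1/2)]
     else if i \<in> {3..N-2} \<and> j = 2 then [((i, 2), 1/2), ((i-1, 2), 1/2)]
     else if i = 2 \<and> j = 2 then [((2, 2), 1/3), ((0, 0), 2/3)]
     else [((i, j), 1)])"
| "hat_law N (i, j) Null = [((i, j), 1)]"

definition hat_P :: "nat \<Rightarrow> state \<Rightarrow> action \<Rightarrow> state pmf" where
  "hat_P N s a = pmf_of_list (hat_law N s a)"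

lemma pmf_of_list_wf_hat_law: "pmf_of_list_wf (hat_law N s a)"
  by (cases s; cases a)
    (auto simp: pmf_of_list_wf_def move_fst_def move_snd_def
      law_1_def law_2_def law_1'_def law_2'_def)

definition hat_r :: "nat \<Rightarrow> state \<Rightarrow> action \<Rightarrow> real" where
  "hat_r N s a = (if s = (N, N) then 1 else 0)"


section \<open>The sets of optimal actions\<close>

definition lambda_c :: real where
  "lambda_c = 15/17"

text \<open>Only \<open>k = 1\<close> and \<open>k = 2\<close> are used.\<close>

fun A_star :: "nat \<Rightarrow> nat \<Rightarrow> state \<Rightarrow> action set" where
  "A_star N k (i, j) =
    (if i = N \<and> j = N then {Null}
     else if i = N \<and> (j = N-2 \<or> j = N-4) then {A11}
     else if (i = N-2 \<or> i = N-4) \<and> j = N then {A21}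
     else if i = N \<and> j = N-3 then {A12}
     else if i = N-3 \<and> j = N then {A22}
     else if i = N \<and> j \<in> {2..N-5} then (if k = 1 then {A11} else {A12})
     else if i \<in> {2..N-5} \<and> j = N then (if k = 1 then {A21} else {A22})
     else if i = N-2 \<and> j = N-3 then {A12}
     else if i = N-3 \<and> j = N-2 then {A22}
     else if i = N-2 \<and> (j \<in> {2..N-4} \<or> j = N-2) then {A0}
     else if (i \<in> {2..N-4} \<or> i = N-2) \<and> j = N-2 then {A0}
     else if i = N-3 \<and> j = N-3 then {A12, A22}
     else if i = N-3 \<and> j \<in> {2..N-4} then {A0}
     else if i \<in> {2..N-4} \<and> j = N-3 then {A0}
     else if i \<in> {2..N-4} \<and> j \<in> {2..N-4} then {A0}
     else {})"

end

theory Submission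
  imports Defs
begin

text \<open>
  By the discounted occupation identity, \<open>f s\<close> minus the value of a policy is the discounted expected
  sum of its Bellman gaps \<open>f - r - \<lambda> P f\<close>. So if \<open>f\<close> has nonnegative gaps and every state has an action
  with gap \<open>0\<close>, then a policy is optimal iff all its gaps vanish, and it remains to guess \<open>f\<close> and to
  find the sign of every gap.

  Put \<open>\<lambda> = 1 / (1 + t)\<close>, and count coordinates from the target: index \<open>0\<close> is \<open>N\<close>, index \<open>p \<ge> 1\<close> is
  \<open>N - 1 - p\<close>. The candidate \<open>f\<close> is then, up to a constant factor, a table \<open>val t p q\<close> that does not
  depend on \<open>N\<close> and is defined by the claimed optimal actions. Each gap is a linear combination of
  shifts of the table, so it obeys the recursion of the table, whose coefficients are positive:
  a gap that is positive near the edges and corners is positive everywhere. The corner cases are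
  polynomials in \<open>t\<close> with positive coefficients. Only on the edge does the choice between the one-step
  and the two-step action depend on \<open>t\<close>: it turns at \<open>t = 2/15\<close>, that is \<open>\<lambda> = 15/17\<close>.
\<close>

section \<open>Values of stationary policies\<close>

text \<open>If an action stays put with probability w, solving its optimality equation for the
  current state produces the factor 1 - w + t. This is why t replaces the discount factor: all
  recursions get linear factors with positive coefficients. Formally at t = 0 the table is
  constantly 1 and competing moves tie, so each comparison is decided by terms carrying a factor t,
  and the estimates have to be exact at t = 0. The constant 2/15 comes from the edge: if consecutive
  values have the one-step ratio 2 / (2 + 3 t), the advantage of one more one-step move over the
  two-step move is a positive multiple of t (2 - 15 t). The obstacle is that the recursion is not
  uniform. Column 1 has its own coefficients, three states near the corner use a two-step action,
  and the edge changes its rule with t. A gap whose shifts reach these places mixes several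
  recursions, so these columns get inductions of their own, fed by bounds on the ratio of
  consecutive edge values.\<close>

primrec step_law :: "('s \<Rightarrow> 's pmf) \<Rightarrow> 's \<Rightarrow> nat \<Rightarrow> 's pmf" where
  "step_law K s 0 = return_pmf s"
| "step_law K s (Suc t) = bind_pmf (step_law K s t) K"

lemma sets_trajectories: "sets (trajectories K s) = sets (PiM UNIV (\<lambda>_. count_space UNIV))"
proof -
  interpret Ionescu_Tulcea "chain_step K s" "\<lambda>_. count_space UNIV"
    by (rule Ionescu_Tulcea_chain_step)
  show ?thesis unfolding trajectories_def by (rule PF.sets_lim)
qed

lemma measurable_trajectories_component:
  "(\<lambda>\<omega>. \<omega> t) \<in> measurable (trajectories K s) (count_space UNIV)"
  unfolding measurable_cong_sets[OF sets_trajectories refl]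
  by (rule measurable_component_singleton) simp

text \<open>Only these marginals of the path measure matter, since the expectation of a discounted
  sum splits into expectations at single times. The law of an initial segment is the composition
  \<open>C\<close> of the kernels; keeping only its last coordinate turns the composition into
  \<open>bind_pmf\<close>.\<close>

lemma distr_trajectories:
  fixes K :: "'s \<Rightarrow> 's pmf"
  shows "distr (trajectories K s) (count_space UNIV) (\<lambda>\<omega>. \<omega> t) = measure_pmf (step_law K s t)"
proof -
  let ?M = "\<lambda>_::nat. count_space (UNIV :: 's set)"
  interpret Ionescu_Tulcea "chain_step K s" ?M
    by (rule Ionescu_Tulcea_chain_step)
  have und: "(\<lambda>_. undefined) \<in> space (PiM {0..<0} ?M)"
    by (simp add: space_PiM)
  have comp: "(\<lambda>\<omega>. \<omega> n) \<in> measurable (PiM {0..<Suc n} ?M) (count_space UNIV)" for n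
    by (intro measurable_component_singleton) auto
  have eP_comp: "distr (eP n \<omega>) (count_space UNIV) (\<lambda>\<omega>. \<omega> n) = chain_step K s n \<omega>"
    if w: "\<omega> \<in> space (PiM {0..<n} ?M)" for n \<omega>
  proof -
    have "distr (eP n \<omega>) (count_space UNIV) (\<lambda>\<omega>. \<omega> n)
        = distr (chain_step K s n \<omega>) (count_space UNIV) ((\<lambda>\<omega>. \<omega> n) \<circ> fun_upd \<omega> n)"
      unfolding eP_def
    proof (rule distr_distr[OF comp])
      have "fun_upd \<omega> n \<in> measurable (count_space UNIV) (PiM {0..<Suc n} ?M)"
        using w by (intro measurable_fun_upd[where J="{0..<n}"]) auto
      then show "fun_upd \<omega> n \<in> measurable (chain_step K s n \<omega>) (PiM {0..<Suc n} ?M)"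
        by (simp only: measurable_cong_sets[OF sets_P[OF w] refl])
    qed
    also have "\<dots> = distr (chain_step K s n \<omega>) (chain_step K s n \<omega>) (\<lambda>x. x)"
      using sets_P[OF w] by (intro distr_cong) auto
    finally show ?thesis by (simp add: distr_id)
  qed
  have C_comp: "distr (C 0 (Suc n) (\<lambda>_. undefined)) (count_space UNIV) (\<lambda>\<omega>. \<omega> n)
      = measure_pmf (step_law K s n)" for n
  proof (induction n)
    case 0
    have "C 0 (Suc 0) (\<lambda>_. undefined) = eP 0 (\<lambda>_. undefined)"
      using bind_return[OF measurable_eP und] by simp
    then show ?case
      using eP_comp[OF und] by simp
  next
    case (Suc n)
    let ?C = "C 0 (Suc n) (\<lambda>_. undefined)"
    have ne: "space ?C \<noteq> {}" using prob_space.not_empty[OF prob_space_C[OF und]] .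
    have setsC: "sets ?C = sets (PiM {0..<Suc n} ?M)" using sets_C[OF und, of "Suc n"] by simp
    have "distr (C 0 (Suc (Suc n)) (\<lambda>_. undefined)) (count_space UNIV) (\<lambda>\<omega>. \<omega> (Suc n))
       = distr (?C \<bind> eP (Suc n)) (count_space UNIV) (\<lambda>\<omega>. \<omega> (Suc n))"
      by simp
    also have "\<dots> = ?C \<bind> (\<lambda>\<omega>. distr (eP (Suc n) \<omega>) (count_space UNIV) (\<lambda>\<omega>. \<omega> (Suc n)))"
    proof (rule distr_bind[OF _ ne comp])
      show "eP (Suc n) \<in> measurable ?C (subprob_algebra (PiM {0..<Suc (Suc n)} ?M))"
        unfolding measurable_cong_sets[OF setsC refl] by (rule measurable_eP)
    qed
    also have "\<dots> = ?C \<bind> (\<lambda>\<omega>. measure_pmf (K (\<omega> n)))"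
      using sets_eq_imp_space_eq[OF setsC]
      by (intro bind_cong refl) (simp add: eP_comp)
    also have "\<dots> = distr ?C (count_space UNIV) (\<lambda>\<omega>. \<omega> n) \<bind> (\<lambda>x. measure_pmf (K x))"
    proof (rule bind_distr[where K="count_space UNIV", symmetric, OF _ _ ne])
      show "(\<lambda>\<omega>. \<omega> n) \<in> measurable ?C (count_space UNIV)"
        unfolding measurable_cong_sets[OF setsC refl] by (rule comp)
    qed (auto simp: measure_pmf_in_subprob_algebra)
    also have "\<dots> = measure_pmf (step_law K s (Suc n))"
      by (simp add: Suc measure_pmf_bind del: C.simps)
    finally show ?case .
  qed
  \<comment> \<open>\<open>CI J\<close> restricts the law of the first \<open>up_to J\<close>
    coordinates; for this \<open>J\<close> that is exactly the segment up to time
    \<open>t\<close>.\<close>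
  have upt: "up_to {0..<Suc t} = Suc t"
  proof (rule antisym)
    show "up_to {0..<Suc t} \<le> Suc t" by (simp add: up_to_iff_Ico)
    show "Suc t \<le> up_to {0..<Suc t}" using up_to_less[of "{0..<Suc t}" t] by simp
  qed
  let ?J = "{0..<Suc t}" and ?C = "C 0 (Suc t) (\<lambda>_. undefined)"
  have restrict: "(\<lambda>f. restrict f ?J) \<in> measurable (PiM I ?M) (PiM ?J ?M)" if "?J \<subseteq> I" for I
    by (rule measurable_restrict_subset[OF that])
  have "(\<lambda>f. restrict f ?J) \<in> measurable PF.lim (PiM ?J ?M)"
    unfolding measurable_cong_sets[OF PF.sets_lim refl] by (rule restrict) simp
  then have "distr (trajectories K s) (count_space UNIV) (\<lambda>\<omega>. \<omega> t)
     = distr (distr PF.lim (PiM ?J ?M) (\<lambda>x. restrict x ?J)) (count_space UNIV) (\<lambda>\<omega>. \<omega> t)"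
    unfolding trajectories_def by (subst distr_distr[OF comp]) (simp_all add: comp_def)
  also have "\<dots> = distr (distr ?C (PiM ?J ?M) (\<lambda>x. restrict x ?J)) (count_space UNIV) (\<lambda>\<omega>. \<omega> t)"
    using distr_lim[of ?J] unfolding CI_def upt by (simp del: C.simps)
  also have "\<dots> = distr ?C (count_space UNIV) (\<lambda>\<omega>. \<omega> t)"
  proof (subst distr_distr[OF comp])
    show "(\<lambda>f. restrict f ?J) \<in> measurable ?C (PiM ?J ?M)"
      unfolding measurable_cong_sets[OF sets_C[OF und] refl] by (rule restrict) simp
  qed (simp add: comp_def del: C.simps)
  finally show ?thesis using C_comp by simp
qed

lemma prob_space_trajectories: "prob_space (trajectories K s)"
  by (rule prob_space_distrD[OF measurable_trajectories_component])
    (simp add: distr_trajectories prob_space_measure_pmf)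

lemma integral_trajectories:
  fixes g :: "'s \<Rightarrow> real"
  shows "(\<integral>\<omega>. g (\<omega> t) \<partial>trajectories K s) = measure_pmf.expectation (step_law K s t) g"
  unfolding distr_trajectories[symmetric]
  by (subst integral_distr[OF measurable_trajectories_component]) auto

text \<open>The geometric series \<open>lam ^ t * b\<close> dominates, so expectation and sum can be
  exchanged.\<close>

lemma policy_value_sums:
  fixes r :: "'s \<Rightarrow> 'a \<Rightarrow> real"
  assumes lam: "0 \<le> lam" "lam < 1" and r: "\<And>s a. \<bar>r s a\<bar> \<le> b"
  shows "(\<lambda>t. lam ^ t * measure_pmf.expectation (step_law (\<lambda>x. P x (d x)) s t) (\<lambda>x. r x (d x)))
    sums policy_value P r lam d s"
proof -
  let ?T = "trajectories (\<lambda>x. P x (d x)) s"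
  interpret prob_space ?T by (rule prob_space_trajectories)
  have meas: "(\<lambda>\<omega>. g (\<omega> t)) \<in> borel_measurable ?T" for g :: "'s \<Rightarrow> real" and t
    by (rule measurable_compose[OF measurable_trajectories_component]) simp
  have int: "integrable ?T (\<lambda>\<omega>. lam ^ t * r (\<omega> t) (d (\<omega> t)))" for t
    using r by (intro integrable_mult_right integrable_const_bound[where B=b] meas[of "\<lambda>x. r x (d x)"]) auto
  have E: "(\<integral>\<omega>. lam ^ t * r (\<omega> t) (d (\<omega> t)) \<partial>?T)
      = lam ^ t * measure_pmf.expectation (step_law (\<lambda>x. P x (d x)) s t) (\<lambda>x. r x (d x))" for t
    by (simp only: integral_mult_right_zero integral_trajectories[where g="\<lambda>x. r x (d x)"])
  have bound: "norm (lam ^ t * r x a) \<le> lam ^ t * b" for t x a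
    using lam r by (auto simp: abs_mult intro!: mult_left_mono)
  have summ: "summable (\<lambda>t. lam ^ t * b)"
    using lam by (intro summable_mult2 summable_geometric) auto
  have "(\<lambda>t. \<integral>\<omega>. lam ^ t * r (\<omega> t) (d (\<omega> t)) \<partial>?T) sums (\<integral>\<omega>. (\<Sum>t. lam ^ t * r (\<omega> t) (d (\<omega> t))) \<partial>?T)"
  proof (rule sums_integral[OF int])
    show "AE \<omega> in ?T. summable (\<lambda>t. norm (lam ^ t * r (\<omega> t) (d (\<omega> t))))"
    proof (rule AE_I2)
      fix \<omega>
      have "norm (norm (lam ^ t * r (\<omega> t) (d (\<omega> t)))) \<le> lam ^ t * b" for t
        using bound by simp
      then show "summable (\<lambda>t. norm (lam ^ t * r (\<omega> t) (d (\<omega> t))))"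
        by (intro summable_comparison_test'[OF summ])
    qed
    have int_le: "(\<integral>\<omega>. norm (lam ^ t * r (\<omega> t) (d (\<omega> t))) \<partial>?T) \<le> lam ^ t * b" for t
    proof -
      have "(\<integral>\<omega>. norm (lam ^ t * r (\<omega> t) (d (\<omega> t))) \<partial>?T) \<le> (\<integral>\<omega>. lam ^ t * b \<partial>?T)"
        using bound by (intro integral_mono integrable_norm int) auto
      then show ?thesis by (simp add: prob_space)
    qed
    show "summable (\<lambda>t. \<integral>\<omega>. norm (lam ^ t * r (\<omega> t) (d (\<omega> t))) \<partial>?T)"
    proof (rule summable_comparison_test'[OF summ])
      fix t
      have "0 \<le> (\<integral>\<omega>. norm (lam ^ t * r (\<omega> t) (d (\<omega> t))) \<partial>?T)"
        by (intro integral_nonneg_AE AE_I2) simp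
      then show "norm (\<integral>\<omega>. norm (lam ^ t * r (\<omega> t) (d (\<omega> t))) \<partial>?T) \<le> lam ^ t * b"
        using int_le[of t] by simp
    qed
  qed
  then show ?thesis
    unfolding policy_value_def E .
qed

lemma integrable_pmf_bounded:
  fixes g :: "'s \<Rightarrow> real"
  assumes "\<And>x. \<bar>g x\<bar> \<le> c"
  shows "integrable (measure_pmf p) g"
proof (rule measure_pmf.integrable_const_bound)
  show "AE x in measure_pmf p. norm (g x) \<le> c"
    using assms by (intro AE_I2) simp
qed simp

lemma abs_expectation_pmf_le:
  fixes g :: "'s \<Rightarrow> real"
  assumes "\<And>x. \<bar>g x\<bar> \<le> c"
  shows "\<bar>measure_pmf.expectation p g\<bar> \<le> c"
proof -
  have "\<bar>measure_pmf.expectation p g\<bar> \<le> measure_pmf.expectation p (\<lambda>x. \<bar>g x\<bar>)"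
    by (rule integral_abs_bound)
  also have "\<dots> \<le> measure_pmf.expectation p (\<lambda>_. c)"
    using assms by (intro integral_mono integrable_abs integrable_pmf_bounded[OF assms]) auto
  finally show ?thesis by simp
qed

text \<open>Iterated integration is used in its nonnegative form: \<open>g\<close> is shifted by its
  bound \<open>c\<close>, and the constant is removed at the end.\<close>

lemma expectation_bind_pmf:
  fixes g :: "'s \<Rightarrow> real"
  assumes g: "\<And>x. \<bar>g x\<bar> \<le> c"
  shows "measure_pmf.expectation (bind_pmf p K) g
    = measure_pmf.expectation p (\<lambda>x. measure_pmf.expectation (K x) g)"
proof -
  let ?h = "\<lambda>x. g x + c"
  have h: "0 \<le> ?h x" "\<bar>?h x\<bar> \<le> 2 * c" for x
    using g[of x] by (auto simp: abs_if split: if_splits)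
  have K: "0 \<le> measure_pmf.expectation q ?h" "\<bar>measure_pmf.expectation q ?h\<bar> \<le> 2 * c" for q
    using abs_expectation_pmf_le[of ?h "2 * c", OF h(2)] h(1) by (auto intro!: integral_nonneg_AE)
  have "ennreal (measure_pmf.expectation (bind_pmf p K) ?h) = (\<integral>\<^sup>+x. \<integral>\<^sup>+y. ?h y \<partial>K x \<partial>p)"
    using h integrable_pmf_bounded[of ?h "2 * c", OF h(2)]
    by (simp add: nn_integral_eq_integral[symmetric])
  also have "\<dots> = (\<integral>\<^sup>+x. ennreal (measure_pmf.expectation (K x) ?h) \<partial>p)"
    using h integrable_pmf_bounded[of ?h "2 * c", OF h(2)]
    by (simp add: nn_integral_eq_integral)
  also have "\<dots> = ennreal (measure_pmf.expectation p (\<lambda>x. measure_pmf.expectation (K x) ?h))"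
    using K integrable_pmf_bounded[of "\<lambda>x. measure_pmf.expectation (K x) ?h" "2 * c", OF K(2)]
    by (simp add: nn_integral_eq_integral)
  finally have "measure_pmf.expectation (bind_pmf p K) ?h
      = measure_pmf.expectation p (\<lambda>x. measure_pmf.expectation (K x) ?h)"
    using K by (simp add: integral_nonneg_AE)
  then show ?thesis
    using integrable_pmf_bounded[of g c, OF g]
      integrable_pmf_bounded[of "\<lambda>x. measure_pmf.expectation (K x) g" c, OF abs_expectation_pmf_le[OF g]]
    by simp
qed

section \<open>Bellman gaps and the optimality criterion\<close>

definition bellman_gap ::
  "('s \<Rightarrow> 'a \<Rightarrow> 's pmf) \<Rightarrow> ('s \<Rightarrow> 'a \<Rightarrow> real) \<Rightarrow> real \<Rightarrow> ('s \<Rightarrow> real) \<Rightarrow> 's \<Rightarrow> 'a \<Rightarrow> real" where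
  "bellman_gap P r lam f s a = f s - r s a - lam * measure_pmf.expectation (P s a) f"

text \<open>The expected gap at time t contains the expectations of \<open>f\<close> at times t and
  t + 1, the latter multiplied by \<open>lam\<close>. After discounting, these terms telescope, and
  boundedness of \<open>f\<close> kills the limit term.\<close>

lemma bellman_gap_sums:
  fixes r :: "'s \<Rightarrow> 'a \<Rightarrow> real"
  assumes lam: "0 \<le> lam" "lam < 1" and r: "\<And>s a. \<bar>r s a\<bar> \<le> b" and f: "\<And>s. \<bar>f s\<bar> \<le> c"
  shows "(\<lambda>t. lam ^ t * measure_pmf.expectation (step_law (\<lambda>x. P x (d x)) s t)
      (\<lambda>x. bellman_gap P r lam f x (d x))) sums (f s - policy_value P r lam d s)"
proof -
  let ?K = "\<lambda>x. P x (d x)"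
  let ?E = "\<lambda>t. measure_pmf.expectation (step_law ?K s t)"
  have Ef: "?E (Suc t) f = ?E t (\<lambda>x. measure_pmf.expectation (?K x) f)" for t
    by (simp add: expectation_bind_pmf[OF f])
  have gap: "?E t (\<lambda>x. bellman_gap P r lam f x (d x))
      = ?E t f - ?E t (\<lambda>x. r x (d x)) - lam * ?E (Suc t) f" for t
  proof -
    note i = integrable_pmf_bounded[of f c, OF f] integrable_pmf_bounded[of "\<lambda>x. r x (d x)" b, OF r]
      integrable_pmf_bounded[of "\<lambda>x. measure_pmf.expectation (?K x) f" c, OF abs_expectation_pmf_le[OF f]]
    show ?thesis unfolding bellman_gap_def Ef using i by simp
  qed
  have lim: "(\<lambda>t. lam ^ t * ?E t f) \<longlonglongrightarrow> 0"
  proof (rule Lim_null_comparison)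
    show "\<forall>\<^sub>F t in sequentially. norm (lam ^ t * ?E t f) \<le> lam ^ t * c"
      using lam abs_expectation_pmf_le[OF f] by (auto simp: abs_mult intro!: mult_left_mono always_eventually)
    show "(\<lambda>t. lam ^ t * c) \<longlonglongrightarrow> 0"
      using lam by (intro tendsto_mult_left_zero LIMSEQ_realpow_zero) auto
  qed
  have "(\<lambda>t. lam ^ t * ?E t f - lam ^ Suc t * ?E (Suc t) f) sums (lam ^ 0 * ?E 0 f - 0)"
    by (rule telescope_sums'[OF lim])
  from sums_diff[OF this policy_value_sums[where P=P and d=d and s=s and r=r, OF lam r]]
  show ?thesis
    by (simp add: gap algebra_simps)
qed

text \<open>A greedy rule attains \<open>f\<close>, so an optimal policy must attain it from every
  starting state. A positive gap at \<open>s\<close> is already a loss at time 0 for the start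
  \<open>s\<close>, hence no gap may be positive anywhere, even at states that other starts never
  reach.\<close>

lemma optimal_policy_iff_bellman_gap_eq_0:
  fixes r :: "'s \<Rightarrow> 'a \<Rightarrow> real"
  assumes lam: "0 \<le> lam" "lam < 1" and r: "\<And>s a. \<bar>r s a\<bar> \<le> b" and f: "\<And>s. \<bar>f s\<bar> \<le> c"
    and closed: "\<And>s a. s \<in> S \<Longrightarrow> a \<in> A s \<Longrightarrow> set_pmf (P s a) \<subseteq> S"
    and nonneg: "\<And>s a. s \<in> S \<Longrightarrow> a \<in> A s \<Longrightarrow> 0 \<le> bellman_gap P r lam f s a"
    and greedy: "\<And>s. s \<in> S \<Longrightarrow> \<exists>a\<in>A s. bellman_gap P r lam f s a = 0"
    and d: "decision_rule S A d"
  shows "optimal_policy S A P r lam d \<longleftrightarrow> (\<forall>s\<in>S. bellman_gap P r lam f s (d s) = 0)"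
proof -
  let ?g = "\<lambda>d x. bellman_gap P r lam f x (d x)"
  have support: "set_pmf (step_law (\<lambda>x. P x (d x)) s t) \<subseteq> S"
    if "decision_rule S A d" "s \<in> S" for d s t
  proof (induction t)
    case (Suc t)
    show ?case
    proof
      fix y assume "y \<in> set_pmf (step_law (\<lambda>x. P x (d x)) s (Suc t))"
      then obtain x where "x \<in> S" "y \<in> set_pmf (P x (d x))"
        using Suc by auto
      then show "y \<in> S"
        using closed[of x "d x"] that by (auto simp: decision_rule_def)
    qed
  qed (simp add: that)
  have E_nonneg: "0 \<le> measure_pmf.expectation (step_law (\<lambda>x. P x (d x)) s t) (?g d)"
    if "decision_rule S A d" "s \<in> S" for d s t
    using that support[OF that, of t] nonneg
    by (intro integral_nonneg_AE) (auto simp: AE_measure_pmf_iff decision_rule_def)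
  have upper: "policy_value P r lam d s + ?g d s \<le> f s" if "decision_rule S A d" "s \<in> S" for d s
  proof -
    note sums = bellman_gap_sums[where P=P and d=d and s=s and f=f and r=r, OF lam r f]
    \<comment> \<open>Only the term at time 0 is kept, which is the gap at \<open>s\<close> itself;
      all later terms are nonnegative.\<close>
    have "sum (\<lambda>t. lam ^ t * measure_pmf.expectation (step_law (\<lambda>x. P x (d x)) s t) (?g d)) {0}
        \<le> f s - policy_value P r lam d s"
      unfolding sums_unique[OF sums] using lam E_nonneg[OF that] sums_summable[OF sums]
      by (intro sum_le_suminf) auto
    then show ?thesis by simp
  qed
  have eq: "policy_value P r lam d s = f s"
    if "decision_rule S A d" "s \<in> S" "\<forall>s\<in>S. ?g d s = 0" for d s
  proof -
    have "measure_pmf.expectation (step_law (\<lambda>x. P x (d x)) s t) (?g d) = 0" for t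
      using that support[OF that(1,2), of t]
      by (intro integral_eq_zero_AE) (auto simp: AE_measure_pmf_iff)
    then show ?thesis
      using bellman_gap_sums[where P=P and d=d and s=s and f=f and r=r, OF lam r f]
      by (simp add: sums_iff)
  qed
  obtain e where e: "\<And>s. s \<in> S \<Longrightarrow> e s \<in> A s \<and> ?g e s = 0"
    using greedy by metis
  have e_rule: "decision_rule S A e"
    using e by (auto simp: decision_rule_def)
  show ?thesis
  proof
    assume opt: "optimal_policy S A P r lam d"
    show "\<forall>s\<in>S. ?g d s = 0"
    proof
      fix s assume s: "s \<in> S"
      have "f s \<le> policy_value P r lam d s"
        using opt e_rule s eq[OF e_rule s] e unfolding optimal_policy_def by metis
      then show "?g d s = 0"
        using upper[OF d s] nonneg[OF s, of "d s"] d s by (auto simp: decision_rule_def)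
    qed
  next
    assume zero: "\<forall>s\<in>S. ?g d s = 0"
    show "optimal_policy S A P r lam d"
      unfolding optimal_policy_def
    proof (intro ballI allI impI)
      fix s d' assume s: "s \<in> S" and d': "decision_rule S A d'"
      show "policy_value P r lam d' s \<le> policy_value P r lam d s"
        using upper[OF d' s] nonneg[OF s, of "d' s"] eq[OF d s zero] d' s
        by (auto simp: decision_rule_def)
    qed
  qed
qed

text \<open>A list may name the same state several times, and its probability is then the sum of
  these entries; exchanging the two sums collects them.\<close>

lemma expectation_pmf_of_list:
  fixes f :: "'s \<Rightarrow> real"
  assumes "pmf_of_list_wf xs"
  shows "measure_pmf.expectation (pmf_of_list xs) f = (\<Sum>(x, p)\<leftarrow>xs. p * f x)"
proof -
  have "measure_pmf.expectation (pmf_of_list xs) f = (\<Sum>x\<in>set (map fst xs). f x * pmf (pmf_of_list xs) x)"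
    using set_pmf_of_list[OF assms] by (intro integral_measure_pmf_real) auto
  also have "\<dots> = (\<Sum>x\<in>set (map fst xs). \<Sum>z\<leftarrow>xs. (if fst z = x then snd z * f x else 0))"
  proof (intro sum.cong refl)
    fix x
    have "f x * sum_list (map snd (filter (\<lambda>z. fst z = x) ys))
        = (\<Sum>z\<leftarrow>ys. if fst z = x then snd z * f x else 0)" for ys :: "('s \<times> real) list"
      by (induction ys) (auto simp: algebra_simps)
    then show "f x * pmf (pmf_of_list xs) x = (\<Sum>z\<leftarrow>xs. if fst z = x then snd z * f x else 0)"
      by (simp add: pmf_pmf_of_list[OF assms])
  qed
  also have "\<dots> = (\<Sum>z\<leftarrow>xs. \<Sum>x\<in>set (map fst xs). (if fst z = x then snd z * f x else 0))"
  proof -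
    have "(\<Sum>x\<in>A. \<Sum>z\<leftarrow>ys. (if fst z = x then snd z * f x else 0))
        = (\<Sum>z\<leftarrow>ys. \<Sum>x\<in>A. (if fst z = x then snd z * f x else 0))"
      for A and ys :: "('s \<times> real) list"
      by (induction ys) (simp_all only: list.map sum_list.Nil sum_list.Cons sum.distrib sum.neutral_const)
    then show ?thesis .
  qed
  also have "\<dots> = (\<Sum>(x, p)\<leftarrow>xs. p * f x)"
    by (intro arg_cong[of _ _ sum_list] map_cong refl) (auto simp: sum.delta split: prod.splits)
  finally show ?thesis .
qed

section \<open>The table of values\<close>

text \<open>Each clause says that the gap of one action is zero, multiplied by a common denominator:
  for \<open>A12\<close> at index 2, the stay probability 7/18 gives 11/18 + t, and the factor 144
  turns this into \<open>88 + 144 * t\<close>. Index 3 uses the one-step action for every t; the tie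
  at t = 2/15 is given to the two-step action.\<close>

fun edge_val :: "real \<Rightarrow> nat \<Rightarrow> real" where
  "edge_val t p =
    (if p = 0 then 1
     else if p = 1 then 3 / (3 + 4 * t)
     else if p = 2 then (31 * edge_val t (p - 1) + 57 * edge_val t (p - 2)) / (88 + 144 * t)
     else if p = 3 \<or> t < 2 / 15 then 2 * edge_val t (p - 1) / (2 + 3 * t)
     else (7 * edge_val t (p - 1) + 5 * edge_val t (p - 2)) / (12 + 27 * t))"

text \<open>The clauses for (2, 1), (1, 2) and (2, 2) belong to the states where a two-step action
  replaces \<open>A0\<close>. At (2, 2) both \<open>A12\<close> and \<open>A22\<close> are claimed
  to be optimal, and the clause follows \<open>A22\<close>.\<close>

fun val :: "real \<Rightarrow> nat \<Rightarrow> nat \<Rightarrow> real" where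
  "val t p q =
    (if q = 0 then edge_val t p
     else if p = 0 then edge_val t q
     else if p = 1 \<and> q = 1
       then (9 * (val t 0 1 + val t 1 0) + 26 * val t 0 0) / (44 + 72 * t)
     else if p = 2 \<and> q \<le> 2 then (31 * val t 1 q + 57 * val t 0 q) / (88 + 144 * t)
     else if p = 1 \<and> q = 2 then (31 * val t p 1 + 57 * val t p 0) / (88 + 144 * t)
     else if q = 1 then (9 * val t p 0 + 8 * val t (p - 1) 1 + 25 * val t (p - 1) 0) / (42 + 72 * t)
     else if p = 1 then (9 * val t 0 q + 8 * val t 1 (q - 1) + 25 * val t 0 (q - 1)) / (42 + 72 * t)
     else (val t (p - 1) q + val t p (q - 1) + 3 * val t (p - 1) (q - 1)) / (5 + 9 * t))"

declare edge_val.simps [simp del] val.simps [simp del]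

lemma val_edge: "val t p 0 = edge_val t p" "val t 0 q = edge_val t q"
  by (simp_all add: val.simps)

lemma val_1_1: "val t 1 1 = (9 * (val t 0 1 + val t 1 0) + 26 * val t 0 0) / (44 + 72 * t)"
  by (subst val.simps) simp

lemma val_2_1: "val t 2 1 = (31 * val t 1 1 + 57 * val t 0 1) / (88 + 144 * t)"
  by (subst val.simps) simp

lemma val_1_2: "val t 1 2 = (31 * val t 1 1 + 57 * val t 1 0) / (88 + 144 * t)"
  by (subst val.simps) simp

lemma val_2_2: "val t 2 2 = (31 * val t 1 2 + 57 * val t 0 2) / (88 + 144 * t)"
  by (subst val.simps) simp

lemma val_row_1:
  "3 \<le> p \<Longrightarrow> val t p 1 = (9 * val t p 0 + 8 * val t (p - 1) 1 + 25 * val t (p - 1) 0) / (42 + 72 * t)"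
  by (subst val.simps) simp

lemma val_column_1:
  "3 \<le> q \<Longrightarrow> val t 1 q = (9 * val t 0 q + 8 * val t 1 (q - 1) + 25 * val t 0 (q - 1)) / (42 + 72 * t)"
  by (subst val.simps) simp

lemma val_inner:
  assumes "2 \<le> p" "2 \<le> q" "3 \<le> p \<or> 3 \<le> q"
  shows "val t p q = (val t (p - 1) q + val t p (q - 1) + 3 * val t (p - 1) (q - 1)) / (5 + 9 * t)"
  by (subst val.simps) (use assms in auto)

text \<open>The only clause without a mirror image is the one at (2, 2), which lies on the
  diagonal.\<close>

lemma val_commute: "val t p q = val t q p"
proof (induction "p + q" arbitrary: p q rule: less_induct)
  case less
  consider "p = 0 \<or> q = 0" | "p = q" | "p = 1" "q = 2" | "p = 2" "q = 1"
    | "p = 1" "3 \<le> q" | "3 \<le> p" "q = 1" | "2 \<le> p" "2 \<le> q" "3 \<le> p \<or> 3 \<le> q"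
    by linarith
  then show ?case
  proof cases
    case 5
    then show ?thesis
      using val_row_1[of q t] val_column_1[of q t] less[of 1 "q - 1"] by (simp add: val_edge)
  next
    case 6
    then show ?thesis
      using val_row_1[of p t] val_column_1[of p t] less[of 1 "p - 1"] by (simp add: val_edge)
  next
    case 7
    then show ?thesis
      using val_inner[of p q t] val_inner[of q p t] less[of "p - 1" q] less[of p "q - 1"]
        less[of "p - 1" "q - 1"] by (auto simp: add_ac)
  qed (use val_1_2[of t] val_2_1[of t] in \<open>auto simp: val_edge\<close>)
qed

section \<open>Closed forms near the corner and base cases of the inductions\<close>

context
  fixes t :: real
  assumes t: "0 < t"
begin

lemma edge_val_0: "edge_val t 0 = 1"
  by (simp add: edge_val.simps)

lemma edge_val_1: "edge_val t 1 = 3 / (3 + 4 * t)"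
  by (simp add: edge_val.simps)

lemma edge_val_2: "edge_val t 2 = (66 + 57 * t) / (2 * (3 + 4 * t) * (11 + 18 * t))"
proof -
  have "edge_val t 2 = (31 * edge_val t 1 + 57 * edge_val t 0) / (88 + 144 * t)"
    by (subst edge_val.simps) simp
  then show ?thesis
    unfolding edge_val_0 edge_val_1 using t by (simp add: divide_simps) (simp add: algebra_simps)
qed

lemma edge_val_3: "edge_val t 3 = (66 + 57 * t) / ((3 + 4 * t) * (11 + 18 * t) * (2 + 3 * t))"
proof -
  have "edge_val t 3 = 2 * edge_val t 2 / (2 + 3 * t)"
    by (subst edge_val.simps) simp
  then show ?thesis
    unfolding edge_val_2 using t by (simp add: divide_simps) (simp add: algebra_simps)
qed

lemmas edge_vals = val_edge edge_val_0 edge_val_1 edge_val_2 edge_val_3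

text \<open>Closed forms go up to index 3 because the edge starts to depend on the position of t
  relative to 2/15 only at index 4. Their denominators consist of the linear factors of the
  recursions, such as 88 + 144 t = 8 (11 + 18 t) and 42 + 72 t = 6 (7 + 12 t).\<close>

lemma val_1_1_eq: "val t 1 1 = (33 + 26 * t) / ((3 + 4 * t) * (11 + 18 * t))"
  unfolding val_1_1 edge_vals using t by (simp add: divide_simps) (simp add: algebra_simps)

lemma val_2_1_eq: "val t 2 1 = (726 + 971 * t) / (2 * (3 + 4 * t) * (11 + 18 * t) ^ 2)"
  unfolding val_2_1 val_1_1_eq edge_vals using t
  by (simp add: divide_simps) (simp add: algebra_simps power2_eq_square)

lemma val_2_2_eq: "val t 2 2 = (31944 + 66778 * t + 29241 * t ^ 2) / (8 * (3 + 4 * t) * (11 + 18 * t) ^ 3)"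
  unfolding val_2_2 val_commute[of t 1 2] val_2_1_eq edge_vals using t
  by (simp add: divide_simps) (simp add: algebra_simps power2_eq_square power3_eq_cube)

lemma val_3_1_eq: "val t 3 1 = (60984 + 210830 * t + 229197 * t ^ 2 + 76950 * t ^ 3) / (12 * (3 + 4 * t) * (11 + 18 * t) ^ 2 * (7 + 12 * t) * (2 + 3 * t))"
proof -
  have eq: "val t 3 1 = (9 * val t 3 0 + 8 * val t 2 1 + 25 * val t 2 0) / (42 + 72 * t)"
    using val_row_1[of 3 t] by simp
  show ?thesis
    unfolding eq val_2_1_eq edge_vals using t
    by (simp add: divide_simps) (simp add: algebra_simps power2_eq_square power3_eq_cube)
qed

lemma val_3_2_eq: "val t 3 2 = (6708240 + 38857616 * t + 83957466 * t ^ 2 + 80196615 * t ^ 3 + 28579716 * t ^ 4) / (24 * (3 + 4 * t) * (11 + 18 * t) ^ 3 * (7 + 12 * t) * (5 + 9 * t) * (2 + 3 * t))"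
proof -
  have eq: "val t 3 2 = (val t 2 2 + val t 3 1 + 3 * val t 2 1) / (5 + 9 * t)"
    using val_inner[of 3 2 t] by simp
  show ?thesis
    unfolding eq val_2_1_eq val_2_2_eq val_3_1_eq edge_vals using t
    by (simp add: divide_simps) (simp add: algebra_simps power_numeral_reduce)
qed

text \<open>As in the other corner inequalities, the difference of the two sides is a quotient of
  polynomials in t with nonnegative coefficients. The numerator is divisible by t because both sides
  agree at t = 0.\<close>

lemma one_step_1_1: "3 * val t 0 1 < (3 + 4 * t) * val t 1 1"
proof -
  have "(3 + 4 * t) * val t 1 1 - (3 * val t 0 1) = (48 * t + 104 * t ^ 2) / ((3 + 4 * t) * (11 + 18 * t))"
    unfolding val_1_1_eq val_2_1_eq val_2_2_eq val_3_1_eq val_3_2_eq edge_vals using t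
    by (simp add: divide_simps) (simp add: algebra_simps power_numeral_reduce)
  also have "0 < \<dots>"
    using t by (simp add: add_pos_pos)
  finally show ?thesis by simp
qed

text \<open>\<open>val t 2 1\<close> stands for \<open>val t 1 2\<close>: interior closed forms are
  listed with the larger index in front.\<close>

lemma one_step_1_2: "3 * val t 0 2 < (3 + 4 * t) * val t 2 1"
proof -
  have "(3 + 4 * t) * val t 2 1 - (3 * val t 0 2) = (186 * t + 403 * t ^ 2) / ((3 + 4 * t) * (11 + 18 * t) ^ 2)"
    unfolding val_1_1_eq val_2_1_eq val_2_2_eq val_3_1_eq val_3_2_eq edge_vals using t
    by (simp add: divide_simps) (simp add: algebra_simps power_numeral_reduce)
  also have "0 < \<dots>"
    using t by (simp add: add_pos_pos)
  finally show ?thesis by simp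
qed

lemma one_step_2_1: "2 * val t 1 1 < (2 + 3 * t) * val t 2 1"
proof -
  have "(2 + 3 * t) * val t 2 1 - (2 * val t 1 1) = (600 * t + 1041 * t ^ 2) / (2 * (3 + 4 * t) * (11 + 18 * t) ^ 2)"
    unfolding val_1_1_eq val_2_1_eq val_2_2_eq val_3_1_eq val_3_2_eq edge_vals using t
    by (simp add: divide_simps) (simp add: algebra_simps power_numeral_reduce)
  also have "0 < \<dots>"
    using t by (simp add: add_pos_pos)
  finally show ?thesis by simp
qed

lemma one_step_3_1: "2 * val t 2 1 < (2 + 3 * t) * val t 3 1"
proof -
  have "(2 + 3 * t) * val t 3 1 - (2 * val t 2 1) = (24722 * t + 89373 * t ^ 2 + 76950 * t ^ 3) / (12 * (3 + 4 * t) * (11 + 18 * t) ^ 2 * (7 + 12 * t))"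
    unfolding val_1_1_eq val_2_1_eq val_2_2_eq val_3_1_eq val_3_2_eq edge_vals using t
    by (simp add: divide_simps) (simp add: algebra_simps power_numeral_reduce)
  also have "0 < \<dots>"
    using t by (simp add: add_pos_pos)
  finally show ?thesis by simp
qed

lemma one_step_2_2: "2 * val t 2 1 < (2 + 3 * t) * val t 2 2"
proof -
  have "(2 + 3 * t) * val t 2 2 - (2 * val t 2 1) = (39396 * t + 118992 * t ^ 2 + 87723 * t ^ 3) / (8 * (3 + 4 * t) * (11 + 18 * t) ^ 3)"
    unfolding val_1_1_eq val_2_1_eq val_2_2_eq val_3_1_eq val_3_2_eq edge_vals using t
    by (simp add: divide_simps) (simp add: algebra_simps power_numeral_reduce)
  also have "0 < \<dots>"
    using t by (simp add: add_pos_pos)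
  finally show ?thesis by simp
qed

lemma one_step_3_2: "2 * val t 2 2 < (2 + 3 * t) * val t 3 2"
proof -
  have "(2 + 3 * t) * val t 3 2 - (2 * val t 2 2) = (1259564 * t + 7834980 * t ^ 2 + 15344613 * t ^ 3 + 9631548 * t ^ 4) / (24 * (3 + 4 * t) * (11 + 18 * t) ^ 3 * (7 + 12 * t) * (5 + 9 * t))"
    unfolding val_1_1_eq val_2_1_eq val_2_2_eq val_3_1_eq val_3_2_eq edge_vals using t
    by (simp add: divide_simps) (simp add: algebra_simps power_numeral_reduce)
  also have "0 < \<dots>"
    using t by (simp add: add_pos_pos)
  finally show ?thesis by simp
qed

text \<open>At (2, 1), and below at (2, 2), moving both coordinates is strictly worse than the
  two-step action that defines the table there.\<close>

lemma both_step_2_1: "9 * val t 2 0 + 8 * val t 1 1 + 25 * val t 1 0 < (42 + 72 * t) * val t 2 1"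
proof -
  have "(42 + 72 * t) * val t 2 1 - (9 * val t 2 0 + 8 * val t 1 1 + 25 * val t 1 0) = (3239 * t + 4590 * t ^ 2) / (2 * (3 + 4 * t) * (11 + 18 * t) ^ 2)"
    unfolding val_1_1_eq val_2_1_eq val_2_2_eq val_3_1_eq val_3_2_eq edge_vals using t
    by (simp add: divide_simps) (simp add: algebra_simps power_numeral_reduce)
  also have "0 < \<dots>"
    using t by (simp add: add_pos_pos)
  finally show ?thesis by simp
qed

lemma both_step_2_2: "2 * val t 2 1 + 3 * val t 1 1 < (5 + 9 * t) * val t 2 2"
proof -
  have "(5 + 9 * t) * val t 2 2 - (2 * val t 2 1 + 3 * val t 1 1) = (42258 * t + 103671 * t ^ 2 + 60993 * t ^ 3) / (8 * (3 + 4 * t) * (11 + 18 * t) ^ 3)"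
    unfolding val_1_1_eq val_2_1_eq val_2_2_eq val_3_1_eq val_3_2_eq edge_vals using t
    by (simp add: divide_simps) (simp add: algebra_simps power_numeral_reduce)
  also have "0 < \<dots>"
    using t by (simp add: add_pos_pos)
  finally show ?thesis by simp
qed

lemma growth_1_2: "(8 + 15 * t) * val t 3 1 < (8 + 9 * t) * val t 2 1"
proof -
  have "(8 + 9 * t) * val t 2 1 - ((8 + 15 * t) * val t 3 1) = (168128 * t + 854118 * t ^ 2 + 1395207 * t ^ 3 + 733374 * t ^ 4) / (12 * (3 + 4 * t) * (11 + 18 * t) ^ 2 * (7 + 12 * t) * (2 + 3 * t))"
    unfolding val_1_1_eq val_2_1_eq val_2_2_eq val_3_1_eq val_3_2_eq edge_vals using t
    by (simp add: divide_simps) (simp add: algebra_simps power_numeral_reduce)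
  also have "0 < \<dots>"
    using t by (simp add: add_pos_pos)
  finally show ?thesis by simp
qed

lemma two_step_3_1: "7 * val t 2 1 + 5 * val t 1 1 < (12 + 27 * t) * val t 3 1"
proof -
  have "(12 + 27 * t) * val t 3 1 - (7 * val t 2 1 + 5 * val t 1 1) = (171380 * t + 652224 * t ^ 2 + 826389 * t ^ 3 + 355590 * t ^ 4) / (4 * (3 + 4 * t) * (11 + 18 * t) ^ 2 * (7 + 12 * t) * (2 + 3 * t))"
    unfolding val_1_1_eq val_2_1_eq val_2_2_eq val_3_1_eq val_3_2_eq edge_vals using t
    by (simp add: divide_simps) (simp add: algebra_simps power_numeral_reduce)
  also have "0 < \<dots>"
    using t by (simp add: add_pos_pos)
  finally show ?thesis by simp
qed

lemma two_step_3_2: "7 * val t 2 2 + 5 * val t 2 1 < (12 + 27 * t) * val t 3 2"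
proof -
  have "(12 + 27 * t) * val t 3 2 - (7 * val t 2 2 + 5 * val t 2 1) = (15286676 * t + 91712712 * t ^ 2 + 206345475 * t ^ 3 + 206507880 * t ^ 4 + 77641416 * t ^ 5) / (8 * (3 + 4 * t) * (11 + 18 * t) ^ 3 * (7 + 12 * t) * (5 + 9 * t) * (2 + 3 * t))"
    unfolding val_1_1_eq val_2_1_eq val_2_2_eq val_3_1_eq val_3_2_eq edge_vals using t
    by (simp add: divide_simps) (simp add: algebra_simps power_numeral_reduce)
  also have "0 < \<dots>"
    using t by (simp add: add_pos_pos)
  finally show ?thesis by simp
qed

lemma two_step_2_3: "31 * val t 3 1 + 57 * val t 0 3 < (88 + 144 * t) * val t 3 2"
proof -
  have "(88 + 144 * t) * val t 3 2 - (31 * val t 3 1 + 57 * val t 0 3) = (1206346 * t + 10589667 * t ^ 2 + 24516135 * t ^ 3 + 17057142 * t ^ 4) / (12 * (3 + 4 * t) * (11 + 18 * t) ^ 2 * (7 + 12 * t) * (5 + 9 * t) * (2 + 3 * t))"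
    unfolding val_1_1_eq val_2_1_eq val_2_2_eq val_3_1_eq val_3_2_eq edge_vals using t
    by (simp add: divide_simps) (simp add: algebra_simps power_numeral_reduce)
  also have "0 < \<dots>"
    using t by (simp add: add_pos_pos)
  finally show ?thesis by simp
qed

lemma decreasing_0_1: "val t 1 1 < val t 0 1"
proof -
  have "val t 0 1 - val t 1 1 = 28 * t / ((3 + 4 * t) * (11 + 18 * t))"
    unfolding val_1_1_eq val_2_1_eq val_2_2_eq val_3_1_eq val_3_2_eq edge_vals using t
    by (simp add: divide_simps)
  also have "0 < \<dots>"
    using t by (simp add: add_pos_pos)
  finally show ?thesis by simp
qed

lemma decreasing_1_1: "val t 2 1 < val t 1 1"
proof -
  have "val t 1 1 - val t 2 1 = (789 * t + 936 * t ^ 2) / (2 * (3 + 4 * t) * (11 + 18 * t) ^ 2)"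
    unfolding val_1_1_eq val_2_1_eq val_2_2_eq val_3_1_eq val_3_2_eq edge_vals using t
    by (simp add: divide_simps) (simp add: algebra_simps power_numeral_reduce)
  also have "0 < \<dots>"
    using t by (simp add: add_pos_pos)
  finally show ?thesis by simp
qed

lemma decreasing_2_1: "val t 3 1 < val t 2 1"
proof -
  have "val t 2 1 - val t 3 1 = (66754 * t + 189789 * t ^ 2 + 132786 * t ^ 3) / (12 * (3 + 4 * t) * (11 + 18 * t) ^ 2 * (7 + 12 * t) * (2 + 3 * t))"
    unfolding val_1_1_eq val_2_1_eq val_2_2_eq val_3_1_eq val_3_2_eq edge_vals using t
    by (simp add: divide_simps) (simp add: algebra_simps power_numeral_reduce)
  also have "0 < \<dots>"
    using t by (simp add: add_pos_pos)
  finally show ?thesis by simp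
qed

lemma decreasing_0_2: "val t 2 1 < val t 0 2"
proof -
  have "val t 0 2 - val t 2 1 = (422 * t + 513 * t ^ 2) / ((3 + 4 * t) * (11 + 18 * t) ^ 2)"
    unfolding val_1_1_eq val_2_1_eq val_2_2_eq val_3_1_eq val_3_2_eq edge_vals using t
    by (simp add: divide_simps) (simp add: algebra_simps power_numeral_reduce)
  also have "0 < \<dots>"
    using t by (simp add: add_pos_pos)
  finally show ?thesis by simp
qed

lemma decreasing_1_2: "val t 2 2 < val t 2 1"
proof -
  have "val t 2 1 - val t 2 2 = (28218 * t + 40671 * t ^ 2) / (8 * (3 + 4 * t) * (11 + 18 * t) ^ 3)"
    unfolding val_1_1_eq val_2_1_eq val_2_2_eq val_3_1_eq val_3_2_eq edge_vals using t
    by (simp add: divide_simps) (simp add: algebra_simps power_numeral_reduce)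
  also have "0 < \<dots>"
    using t by (simp add: add_pos_pos)
  finally show ?thesis by simp
qed

lemma decreasing_2_2: "val t 3 2 < val t 2 2"
proof -
  have "val t 2 2 - val t 3 2 = (8802796 * t + 48562098 * t ^ 2 + 98839116 * t ^ 3 + 87646455 * t ^ 4 + 28422252 * t ^ 5) / (24 * (3 + 4 * t) * (11 + 18 * t) ^ 3 * (7 + 12 * t) * (5 + 9 * t) * (2 + 3 * t))"
    unfolding val_1_1_eq val_2_1_eq val_2_2_eq val_3_1_eq val_3_2_eq edge_vals using t
    by (simp add: divide_simps) (simp add: algebra_simps power_numeral_reduce)
  also have "0 < \<dots>"
    using t by (simp add: add_pos_pos)
  finally show ?thesis by simp
qed

text \<open>The recursion for \<open>val t 4 1\<close> involves the edge value at index 4, which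
  depends on the regime of t. Here it is replaced by its one-step lower bound
  \<open>2 * val t 3 0 / (2 + 3 * t)\<close>, which is valid in both regimes.\<close>

lemma two_step_4_1_aux: "(42 + 72 * t) * (7 * val t 3 1 + 5 * val t 2 1) < (12 + 27 * t) * (18 * val t 3 0 / (2 + 3 * t) + 8 * val t 3 1 + 25 * val t 3 0)"
proof -
  have "(12 + 27 * t) * (18 * val t 3 0 / (2 + 3 * t) + 8 * val t 3 1 + 25 * val t 3 0) - ((42 + 72 * t) * (7 * val t 3 1 + 5 * val t 2 1)) = (3802308 * t + 17258820 * t ^ 2 + 26261973 * t ^ 3 + 14049666 * t ^ 4 + 1030320 * t ^ 5) / (2 * (3 + 4 * t) * (11 + 18 * t) ^ 2 * (7 + 12 * t) * (2 + 3 * t) ^ 2)"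
    unfolding val_1_1_eq val_2_1_eq val_2_2_eq val_3_1_eq val_3_2_eq edge_vals using t
    by (simp add: divide_simps) (simp add: algebra_simps power_numeral_reduce)
  also have "0 < \<dots>"
    using t by (simp add: add_pos_pos)
  finally show ?thesis by simp
qed

text \<open>This is what remains of the inequality at (4, 2) when both recursions are inserted and
  \<open>(12 + 27 * t) * val t 4 1\<close> is replaced by its lower bound from (4, 1).\<close>

lemma two_step_4_2_aux: "7 * val t 2 2 + 7 * val t 3 1 + 21 * val t 2 1 + 5 * (5 + 9 * t) * val t 2 2 - (7 * val t 3 1 + 5 * val t 2 1) < (12 + 27 * t) * (val t 3 2 + 3 * val t 3 1)"
proof -
  have "(12 + 27 * t) * (val t 3 2 + 3 * val t 3 1) - (7 * val t 2 2 + 7 * val t 3 1 + 21 * val t 2 1 + 5 * (5 + 9 * t) * val t 2 2 - (7 * val t 3 1 + 5 * val t 2 1)) = (57051776 * t + 390843912 * t ^ 2 + 1058362416 * t ^ 3 + 1416201084 * t ^ 4 + 937779039 * t ^ 5 + 246824820 * t ^ 6) / (8 * (3 + 4 * t) * (11 + 18 * t) ^ 3 * (7 + 12 * t) * (5 + 9 * t) * (2 + 3 * t))"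
    unfolding val_1_1_eq val_2_1_eq val_2_2_eq val_3_1_eq val_3_2_eq edge_vals using t
    by (simp add: divide_simps) (simp add: algebra_simps power_numeral_reduce)
  also have "0 < \<dots>"
    using t by (simp add: add_pos_pos)
  finally show ?thesis by simp
qed

end

section \<open>The edge\<close>

lemma edge_val_rec_one:
  assumes "3 \<le> p" "p = 3 \<or> t < 2 / 15"
  shows "edge_val t p = 2 * edge_val t (p - 1) / (2 + 3 * t)"
  by (subst edge_val.simps) (use assms in auto)

lemma edge_val_rec_two:
  assumes "4 \<le> p" "2 / 15 \<le> t"
  shows "edge_val t p = (7 * edge_val t (p - 1) + 5 * edge_val t (p - 2)) / (12 + 27 * t)"
  by (subst edge_val.simps) (use assms in auto)

lemma edge_val_pos:
  assumes "0 < t"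
  shows "0 < edge_val t p"
proof (induction p rule: less_induct)
  case (less p)
  consider "p = 0" | "p = 1" | "p = 2" | "3 \<le> p" "p = 3 \<or> t < 2 / 15" | "4 \<le> p" "2 / 15 \<le> t"
    by linarith
  then show ?case
  proof cases
    case 4
    then show ?thesis using edge_val_rec_one[OF 4] less[of "p - 1"] assms by simp
  next
    case 5
    then show ?thesis using edge_val_rec_two[OF 5] less[of "p - 1"] less[of "p - 2"] assms
      by (simp add: add_pos_pos)
  next
    case 2
    then show ?thesis using edge_val_1[OF assms] assms by simp
  next
    case 3
    then show ?thesis using edge_val_2[OF assms] assms by (simp add: add_pos_pos)
  qed (use assms in \<open>simp add: edge_val_0\<close>)
qed

text \<open>
  For \<open>t \<ge> 2/15\<close> the ratio of consecutive values stays in the interval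
  \<open>[2 / (2 + 3 t), (8 + 5 t) / (8 + 18 t)]\<close>, whose upper end is the image of the lower end under the
  two-step recursion; the interval is nonempty exactly when \<open>t \<ge> 2/15\<close>.
\<close>
lemma edge_val_ratio:
  assumes t: "2 / 15 \<le> t" and p: "3 \<le> p"
  shows "2 * edge_val t (p - 1) \<le> (2 + 3 * t) * edge_val t p
    \<and> (8 + 18 * t) * edge_val t p \<le> (8 + 5 * t) * edge_val t (p - 1)"
  using p
proof (induction p rule: dec_induct)
  case base
  \<comment> \<open>The right side exceeds the left by t (15 t - 2), so this is the condition that
    the ratio interval is nonempty.\<close>
  have "2 * (8 + 18 * t) \<le> (8 + 5 * t) * (2 + 3 * t)"
    using mult_left_mono[of "2 / 15" t t] t by (simp add: algebra_simps)
  then have bound: "2 * (8 + 18 * t) * edge_val t 2 \<le> (8 + 5 * t) * (2 + 3 * t) * edge_val t 2"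
    using edge_val_pos[of t 2] t by (intro mult_right_mono) auto
  have rec: "(2 + 3 * t) * edge_val t 3 = 2 * edge_val t 2"
    using edge_val_rec_one[of 3 t] t by simp
  have "(2 + 3 * t) * ((8 + 18 * t) * edge_val t 3) = (8 + 18 * t) * ((2 + 3 * t) * edge_val t 3)"
    by (rule mult.left_commute)
  also have "\<dots> = 2 * (8 + 18 * t) * edge_val t 2"
    unfolding rec by simp
  also have "\<dots> \<le> (2 + 3 * t) * ((8 + 5 * t) * edge_val t 2)"
    using bound by (simp only: mult_ac)
  finally have "(8 + 18 * t) * edge_val t 3 \<le> (8 + 5 * t) * edge_val t 2"
    using t by (simp only: mult_le_cancel_left_pos)
  then show ?case using rec by simp
next
  case (step p)
  let ?a = "edge_val t p" and ?b = "edge_val t (p - 1)"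
  have t0: "0 < t" using t by simp
  have rec: "(12 + 27 * t) * edge_val t (Suc p) = 7 * ?a + 5 * ?b"
    using edge_val_rec_two[of "Suc p" t] step(1) t by simp
  have "(8 + 18 * t) * ((12 + 27 * t) * edge_val t (Suc p)) \<le> (8 + 5 * t) * ((12 + 27 * t) * ?a)"
    unfolding rec
  proof -
    have "(8 + 5 * t) * ((12 + 27 * t) * ?a) - (8 + 18 * t) * (7 * ?a + 5 * ?b)
        = 5 * (4 + 9 * t) * ((2 + 3 * t) * ?a - 2 * ?b)"
      by (simp add: algebra_simps)
    also have "0 \<le> \<dots>" using step.IH t0 by simp
    finally show "(8 + 18 * t) * (7 * ?a + 5 * ?b) \<le> (8 + 5 * t) * ((12 + 27 * t) * ?a)" by simp
  qed
  then have upper: "(8 + 18 * t) * edge_val t (Suc p) \<le> (8 + 5 * t) * ?a"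
    using t0 mult_le_cancel_left_pos[of "12 + 27 * t"
      "(8 + 18 * t) * edge_val t (Suc p)" "(8 + 5 * t) * ?a"] by (simp add: ac_simps)
  \<comment> \<open>The factor \<open>8 + 5 * t\<close> brings in the upper ratio bound for
    \<open>?a\<close>; the surplus is again a multiple of t (15 t - 2).\<close>
  have "(8 + 5 * t) * (2 * (12 + 27 * t) * ?a) \<le> (8 + 5 * t) * ((2 + 3 * t) * (7 * ?a + 5 * ?b))"
  proof -
    have "(8 + 5 * t) * ((2 + 3 * t) * (7 * ?a + 5 * ?b)) - (8 + 5 * t) * (2 * (12 + 27 * t) * ?a)
        = 5 * (2 + 3 * t) * ((8 + 5 * t) * ?b - (8 + 18 * t) * ?a) + 7 * t * (15 * t - 2) * ?a"
      by (simp add: algebra_simps)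
    also have "0 \<le> \<dots>"
      using step.IH t0 t edge_val_pos[OF t0, of p] by (intro add_nonneg_nonneg mult_nonneg_nonneg) auto
    finally show ?thesis by simp
  qed
  then have "2 * (12 + 27 * t) * ?a \<le> (2 + 3 * t) * (7 * ?a + 5 * ?b)"
    using t0 by (simp only: mult_le_cancel_left_pos add_pos_pos mult_pos_pos zero_less_numeral)
  then have "2 * ((12 + 27 * t) * ?a) \<le> (2 + 3 * t) * ((12 + 27 * t) * edge_val t (Suc p))"
    unfolding rec by (simp only: mult.assoc)
  then have "2 * ?a \<le> (2 + 3 * t) * edge_val t (Suc p)"
    using t0 mult_le_cancel_left_pos[of "12 + 27 * t" "2 * ?a" "(2 + 3 * t) * edge_val t (Suc p)"]
    by (simp add: ac_simps)
  with upper show ?case by simp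
qed

lemma edge_one_step:
  assumes t: "0 < t" and p: "2 \<le> p"
  shows "2 * edge_val t (p - 1) \<le> (2 + 3 * t) * edge_val t p"
    and "2 * edge_val t (p - 1) = (2 + 3 * t) * edge_val t p \<longleftrightarrow> p = 3 \<or> (4 \<le> p \<and> t \<le> 2 / 15)"
proof -
  have "2 * edge_val t (p - 1) \<le> (2 + 3 * t) * edge_val t p \<and>
    (2 * edge_val t (p - 1) = (2 + 3 * t) * edge_val t p \<longleftrightarrow> p = 3 \<or> (4 \<le> p \<and> t \<le> 2 / 15))"
  proof -
    consider "p = 2" | "3 \<le> p" "p = 3 \<or> t < 2 / 15" | "4 \<le> p" "2 / 15 \<le> t"
      using p by linarith
    then show ?thesis
    proof cases
      case 1
      have "(2 + 3 * t) * edge_val t 2 - 2 * edge_val t 1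
          = (96 * t + 171 * t ^ 2) / (2 * (3 + 4 * t) * (11 + 18 * t))"
        unfolding edge_val_1[OF t] edge_val_2[OF t] using t
        by (simp add: divide_simps) (simp add: algebra_simps power2_eq_square)
      also have "0 < \<dots>" using t by (simp add: add_pos_pos)
      finally show ?thesis using 1 by simp
    next
      case 2
      then show ?thesis using edge_val_rec_one[OF 2] t by auto
    next
      case 3
      let ?a = "edge_val t (p - 1)" and ?b = "edge_val t (p - 2)"
      have pos: "0 < ?a" by (rule edge_val_pos[OF t])
      have rec: "(12 + 27 * t) * edge_val t p = 7 * ?a + 5 * ?b"
        using edge_val_rec_two[OF 3] t by simp
      have "(8 + 5 * t) * (12 + 27 * t) * ((2 + 3 * t) * edge_val t p - 2 * ?a)
          = (8 + 5 * t) * ((2 + 3 * t) * (7 * ?a + 5 * ?b) - 2 * (12 + 27 * t) * ?a)"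
        unfolding rec[symmetric] by (simp add: algebra_simps)
      also have "\<dots> = 5 * (2 + 3 * t) * ((8 + 5 * t) * ?b - (8 + 18 * t) * ?a) + 7 * t * (15 * t - 2) * ?a"
        by (simp add: algebra_simps)
      finally have eq: "(8 + 5 * t) * (12 + 27 * t) * ((2 + 3 * t) * edge_val t p - 2 * ?a) = \<dots>" .
      have b: "0 \<le> (8 + 5 * t) * ?b - (8 + 18 * t) * ?a"
        using edge_val_ratio[of t "p - 1"] 3 by (simp add: numeral_2_eq_2)
      have le: "2 * ?a \<le> (2 + 3 * t) * edge_val t p"
        using edge_val_ratio[of t p] 3 by simp
      show ?thesis
      proof (cases "t = 2 / 15")
        case True
        \<comment> \<open>At t = 2/15 the ratio interval shrinks to the point 5/6, so its two bounds
          give equality.\<close>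
        show ?thesis using edge_val_ratio[of t p] 3 unfolding True by simp
      next
        case False
        then have "0 < 7 * t * (15 * t - 2) * ?a" using 3 pos t by simp
        then have "0 < (8 + 5 * t) * (12 + 27 * t) * ((2 + 3 * t) * edge_val t p - 2 * ?a)"
          unfolding eq using b t by (intro add_nonneg_pos) auto
        then have "0 < (2 + 3 * t) * edge_val t p - 2 * ?a"
          by (rule zero_less_mult_pos) (use t in simp)
        then have "2 * ?a < (2 + 3 * t) * edge_val t p" by simp
        then show ?thesis using False 3 by auto
      qed
    qed
  qed
  then show "2 * edge_val t (p - 1) \<le> (2 + 3 * t) * edge_val t p"
    and "2 * edge_val t (p - 1) = (2 + 3 * t) * edge_val t p \<longleftrightarrow> p = 3 \<or> (4 \<le> p \<and> t \<le> 2 / 15)"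
    by auto
qed

lemma edge_two_step:
  assumes t: "0 < t" and p: "3 \<le> p"
  shows "7 * edge_val t (p - 1) + 5 * edge_val t (p - 2) \<le> (12 + 27 * t) * edge_val t p"
    and "7 * edge_val t (p - 1) + 5 * edge_val t (p - 2) = (12 + 27 * t) * edge_val t p
      \<longleftrightarrow> 4 \<le> p \<and> 2 / 15 \<le> t"
proof -
  let ?a = "edge_val t (p - 1)" and ?b = "edge_val t (p - 2)"
  have "7 * ?a + 5 * ?b \<le> (12 + 27 * t) * edge_val t p \<and>
    (7 * ?a + 5 * ?b = (12 + 27 * t) * edge_val t p \<longleftrightarrow> 4 \<le> p \<and> 2 / 15 \<le> t)"
  proof -
    consider "p = 3" | "4 \<le> p" "t < 2 / 15" | "4 \<le> p" "2 / 15 \<le> t"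
      using p by linarith
    then show ?thesis
    proof cases
      case 1
      have "(12 + 27 * t) * edge_val t 3 - (7 * edge_val t 2 + 5 * edge_val t 1)
          = (678 * t + 261 * t ^ 2) / (2 * (3 + 4 * t) * (11 + 18 * t) * (2 + 3 * t))"
        unfolding edge_val_1[OF t] edge_val_2[OF t] edge_val_3[OF t] using t
        by (simp add: divide_simps) (simp add: algebra_simps power2_eq_square)
      also have "0 < \<dots>" using t by (simp add: add_pos_pos)
      finally show ?thesis using 1 by (simp add: numeral_2_eq_2 numeral_3_eq_3)
    next
      case 2
      \<comment> \<open>Below 2/15 the values at \<open>p - 1\<close> and \<open>p\<close> both come
        from the one-step rule, so everything is a multiple of \<open>?a\<close>, and the difference
        has the sign of 2 - 15 t.\<close>
      have a: "2 * ?b = (2 + 3 * t) * ?a"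
        using edge_val_rec_one[of "p - 1" t] 2 t by (simp add: numeral_2_eq_2)
      have "2 * (2 + 3 * t) * ((12 + 27 * t) * edge_val t p - (7 * ?a + 5 * ?b))
          = 3 * t * (2 - 15 * t) * ?a"
      proof -
        have e: "(2 + 3 * t) * edge_val t p = 2 * ?a"
          using edge_val_rec_one[of p t] 2 t by simp
        have "2 * (2 + 3 * t) * ((12 + 27 * t) * edge_val t p - (7 * ?a + 5 * ?b))
            = 2 * (12 + 27 * t) * ((2 + 3 * t) * edge_val t p) - (2 + 3 * t) * (14 * ?a + 5 * (2 * ?b))"
          by (simp add: algebra_simps)
        then show ?thesis unfolding e a by (simp add: algebra_simps)
      qed
      also have "0 < \<dots>" using 2 t edge_val_pos[OF t] by simp
      finally have "7 * ?a + 5 * ?b < (12 + 27 * t) * edge_val t p"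
        using t by (simp add: zero_less_mult_iff)
      then show ?thesis using 2 by auto
    next
      case 3
      then show ?thesis using edge_val_rec_two[OF 3] t by auto
    qed
  qed
  then show "7 * ?a + 5 * ?b \<le> (12 + 27 * t) * edge_val t p"
    and "7 * ?a + 5 * ?b = (12 + 27 * t) * edge_val t p \<longleftrightarrow> 4 \<le> p \<and> 2 / 15 \<le> t"
    by auto
qed

lemma edge_val_rec_cases:
  assumes "0 < t" "4 \<le> p"
  shows "(2 + 3 * t) * edge_val t p = 2 * edge_val t (p - 1)
    \<or> (12 + 27 * t) * edge_val t p = 7 * edge_val t (p - 1) + 5 * edge_val t (p - 2)"
  using edge_val_rec_one[of p t] edge_val_rec_two[of p t] assms by (cases "t < 2 / 15") auto

text \<open>A cruder ratio bound than either regime provides, but uniform in t, so that the interior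
  can use it without a case distinction.\<close>

lemma edge_val_upper:
  assumes t: "0 < t" and p: "3 \<le> p"
  shows "(2 + 3 * t) * edge_val t p \<le> (2 + t) * edge_val t (p - 1)"
proof (cases "p = 3 \<or> t < 2 / 15")
  case True
  have "(2 + 3 * t) * edge_val t p = 2 * edge_val t (p - 1)"
    using edge_val_rec_one[OF p True] t by simp
  also have "\<dots> \<le> (2 + t) * edge_val t (p - 1)"
    using edge_val_pos[OF t, of "p - 1"] t by (intro mult_right_mono) auto
  finally show ?thesis .
next
  case False
  let ?a = "edge_val t (p - 1)"
  have "(8 + 18 * t) * ((2 + 3 * t) * edge_val t p) \<le> (2 + 3 * t) * ((8 + 5 * t) * ?a)"
    using edge_val_ratio[of t p] False p mult_left_mono[of "(8 + 18 * t) * edge_val t p" "(8 + 5 * t) * ?a" "2 + 3 * t"]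
    by (simp add: ac_simps)
  also have "\<dots> \<le> (8 + 18 * t) * ((2 + t) * ?a)"
  proof -
    have "(8 + 18 * t) * ((2 + t) * ?a) - (2 + 3 * t) * ((8 + 5 * t) * ?a) = t * (10 + 3 * t) * ?a"
      by (simp add: algebra_simps)
    also have "0 \<le> \<dots>" using edge_val_pos[OF t, of "p - 1"] t by simp
    finally show ?thesis by simp
  qed
  finally show ?thesis using t by (simp add: mult_le_cancel_left_pos)
qed

section \<open>Propagation into the interior\<close>

lemma val_row_1_mult:
  assumes "0 < t" "3 \<le> p"
  shows "(42 + 72 * t) * val t p 1 = 9 * val t p 0 + 8 * val t (p - 1) 1 + 25 * val t (p - 1) 0"
  using val_row_1[OF assms(2), of t] assms(1) by simp

lemma val_inner_mult:
  assumes "0 < t" "2 \<le> p" "2 \<le> q" "3 \<le> p \<or> 3 \<le> q"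
  shows "(5 + 9 * t) * val t p q = val t (p - 1) q + val t p (q - 1) + 3 * val t (p - 1) (q - 1)"
  using val_inner[OF assms(2-4), of t] assms(1) by simp

lemma val_column_1_mult:
  assumes "0 < t" "3 \<le> q"
  shows "(42 + 72 * t) * val t 1 q = 9 * val t 0 q + 8 * val t 1 (q - 1) + 25 * val t 0 (q - 1)"
  using val_column_1[OF assms(2), of t] assms(1) by simp

lemma val_2_mult:
  assumes "0 < t" "1 \<le> q" "q \<le> 2"
  shows "(88 + 144 * t) * val t 2 q = 31 * val t 1 q + 57 * val t 0 q"
proof -
  have "q = 1 \<or> q = 2" using assms by auto
  then show ?thesis using val_2_1[of t] val_2_2[of t] assms(1) by auto
qed

lemma val_pos:
  assumes "0 < t"
  shows "0 < val t p q"
proof (induction "p + q" arbitrary: p q rule: less_induct)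
  case less
  consider "p = 0 \<or> q = 0" | "p = 1" "q = 1" | "p = 1" "q = 2" | "p = 2" "1 \<le> q" "q \<le> 2"
    | "p = 1" "3 \<le> q" | "3 \<le> p" "q = 1" | "2 \<le> p" "2 \<le> q" "3 \<le> p \<or> 3 \<le> q"
    by linarith
  then show ?case
  proof cases
    case 1
    then show ?thesis using edge_val_pos[OF assms] by (auto simp: val_edge)
  next
    case 2
    then show ?thesis using val_1_1_eq[OF assms] assms by (simp add: add_pos_pos)
  next
    case 3
    then show ?thesis using val_1_2[of t] less[of 1 1] less[of 1 0] assms by (simp add: add_pos_pos)
  next
    case 4
    then have "q = 1 \<or> q = 2" by auto
    then show ?thesis
      using val_2_1[of t] val_2_2[of t] less[of 1 q] less[of 0 q] 4 assms by (auto simp: add_pos_pos)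
  next
    case 5
    then show ?thesis
      using val_column_1[of q t] less[of 0 q] less[of 1 "q - 1"] less[of 0 "q - 1"] assms
      by (simp add: add_pos_pos)
  next
    case 6
    then show ?thesis
      using val_row_1[of p t] less[of p 0] less[of "p - 1" 1] less[of "p - 1" 0] assms
      by (simp add: add_pos_pos)
  next
    case 7
    then show ?thesis
      using val_inner[of p q t] less[of "p - 1" q] less[of p "q - 1"] less[of "p - 1" "q - 1"] assms
      by (simp add: add_pos_pos)
  qed
qed

text \<open>
  Any linear combination of the shifts \<open>p, p - 1, \<dots>, p - s\<close> of the value function satisfies the
  recursion of the value function itself, whose coefficients are positive. Inequalities linear in
  the values therefore propagate from the edges and the exceptional states into the interior.
\<close>
lemma shift_combination_pos:
  fixes c :: "nat \<Rightarrow> real" and t :: real and s k :: nat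
  defines "F \<equiv> \<lambda>p q. \<Sum>i\<le>s. c i * val t (p - i) q"
  assumes t: "0 < t" and k: "k \<le> s + 1"
    and edge: "\<And>p. k \<le> p \<Longrightarrow> 0 \<le> F p 0"
    and base: "\<And>p q. k \<le> p \<Longrightarrow> 1 \<le> q \<Longrightarrow> q \<le> 2 \<Longrightarrow> p < s + 3 \<Longrightarrow> 0 < F p q"
    and base': "\<And>p q. k \<le> p \<Longrightarrow> 3 \<le> q \<Longrightarrow> p < s + 2 \<Longrightarrow> 0 < F p q"
    and pq: "k \<le> p" "1 \<le> q"
  shows "0 < F p q"
  using pq
proof (induction "p + q" arbitrary: p q rule: less_induct)
  case less
  \<comment> \<open>The recursion must hold at all shifts \<open>p - i\<close> at once: column 1
    needs \<open>p - s\<close> at least 3, the interior needs \<open>p - s\<close> at least 2 and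
    must avoid (2, 2). The remaining cases are the base cases. The bound on \<open>k\<close> keeps
    \<open>p - 1\<close> admissible.\<close>
  consider "q \<le> 2" "p < s + 3" | "3 \<le> q" "p < s + 2" | "q = 1" "s + 3 \<le> p"
    | "2 \<le> q" "s + 2 \<le> p" "s + 3 \<le> p \<or> 3 \<le> q"
    using less.prems by linarith
  then show ?case
  proof cases
    case 1
    then show ?thesis using base less.prems by blast
  next
    case 2
    then show ?thesis using base' less.prems by blast
  next
    case 3
    have "(42 + 72 * t) * F p 1 = (\<Sum>i\<le>s. c i * ((42 + 72 * t) * val t (p - i) 1))"
      unfolding F_def sum_distrib_left by (intro sum.cong) (auto simp: algebra_simps)
    also have "\<dots> = (\<Sum>i\<le>s. c i * (9 * val t (p - i) 0 + 8 * val t (p - 1 - i) 1 + 25 * val t (p - 1 - i) 0))"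
    proof (intro sum.cong refl)
      fix i assume "i \<in> {..s}"
      then have "3 \<le> p - i" "p - 1 - i = p - i - 1" using 3 by auto
      then show "c i * ((42 + 72 * t) * val t (p - i) 1)
          = c i * (9 * val t (p - i) 0 + 8 * val t (p - 1 - i) 1 + 25 * val t (p - 1 - i) 0)"
        using val_row_1_mult[OF t] by metis
    qed
    also have "\<dots> = 9 * F p 0 + 8 * F (p - 1) 1 + 25 * F (p - 1) 0"
      unfolding F_def sum_distrib_left sum.distrib[symmetric]
      by (intro sum.cong) (auto simp: algebra_simps)
    finally have "(42 + 72 * t) * F p 1 = \<dots>" .
    moreover have "0 < F (p - 1) 1" "0 \<le> F p 0" "0 \<le> F (p - 1) 0"
      using less.hyps[of "p - 1" 1] edge 3 k by auto
    ultimately have "0 < (42 + 72 * t) * F p 1" by simp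
    then show ?thesis using t 3 by (simp add: zero_less_mult_iff)
  next
    case 4
    have "(5 + 9 * t) * F p q = (\<Sum>i\<le>s. c i * ((5 + 9 * t) * val t (p - i) q))"
      unfolding F_def sum_distrib_left by (intro sum.cong) (auto simp: algebra_simps)
    also have "\<dots> = (\<Sum>i\<le>s. c i * (val t (p - 1 - i) q + val t (p - i) (q - 1) + 3 * val t (p - 1 - i) (q - 1)))"
    proof (intro sum.cong refl)
      fix i assume "i \<in> {..s}"
      then have "2 \<le> p - i" "3 \<le> p - i \<or> 3 \<le> q" "p - 1 - i = p - i - 1" using 4 by auto
      then show "c i * ((5 + 9 * t) * val t (p - i) q)
          = c i * (val t (p - 1 - i) q + val t (p - i) (q - 1) + 3 * val t (p - 1 - i) (q - 1))"
        using val_inner_mult[OF t _ 4(1)] by metis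
    qed
    also have "\<dots> = F (p - 1) q + F p (q - 1) + 3 * F (p - 1) (q - 1)"
      unfolding F_def sum_distrib_left sum.distrib[symmetric]
      by (intro sum.cong) (auto simp: algebra_simps)
    finally have "(5 + 9 * t) * F p q = \<dots>" .
    moreover have "0 < F (p - 1) q" "0 < F p (q - 1)" "0 < F (p - 1) (q - 1)"
      using less.hyps[of "p - 1" q] less.hyps[of p "q - 1"] less.hyps[of "p - 1" "q - 1"] 4 k by auto
    ultimately have "0 < (5 + 9 * t) * F p q" by simp
    then show ?thesis using t by (simp add: zero_less_mult_iff)
  qed
qed

text \<open>
  The ratio \<open>(8 + 9 t) / (8 + 15 t)\<close> is the bound on the growth of column \<open>1\<close> under which
  \<open>one_step\<close> propagates along column \<open>2\<close>.
\<close>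
lemma edge_growth:
  assumes t: "0 < t" and q: "2 \<le> q"
  shows "(8 + 15 * t) * edge_val t (Suc q) \<le> (8 + 9 * t) * edge_val t q"
proof -
  have "(8 + 15 * t) * ((2 + 3 * t) * edge_val t (Suc q)) \<le> (8 + 15 * t) * ((2 + t) * edge_val t q)"
    using edge_val_upper[OF t, of "Suc q"] q t by (intro mult_left_mono) auto
  also have "\<dots> = ((2 + 3 * t) * (8 + 9 * t) - 4 * t * (1 + 3 * t)) * edge_val t q"
    by (simp add: algebra_simps)
  also have "\<dots> \<le> (2 + 3 * t) * (8 + 9 * t) * edge_val t q"
    using t edge_val_pos[OF t, of q] by (intro mult_right_mono) auto
  finally have "(2 + 3 * t) * ((8 + 15 * t) * edge_val t (Suc q)) \<le> (2 + 3 * t) * ((8 + 9 * t) * edge_val t q)"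
    by (simp add: mult_ac)
  then show ?thesis using t by (simp only: mult_le_cancel_left_pos add_pos_pos mult_pos_pos zero_less_numeral)
qed

text \<open>The recursion of column 1 is a positive combination of edge values at q and q - 1 and of
  its own previous value, so it inherits the growth bound of the edge.\<close>

lemma column_1_growth:
  assumes t: "0 < t" and q: "2 \<le> q"
  shows "(8 + 15 * t) * val t 1 (Suc q) < (8 + 9 * t) * val t 1 q"
  using q
proof (induction q rule: dec_induct)
  case base
  then show ?case
    using growth_1_2[OF t] val_commute[of t 1 2] val_commute[of t 1 3] by (simp add: numeral_3_eq_3)
next
  case (step q)
  have "(42 + 72 * t) * ((8 + 9 * t) * val t 1 (Suc q) - (8 + 15 * t) * val t 1 (Suc (Suc q)))
      = (8 + 9 * t) * ((42 + 72 * t) * val t 1 (Suc q)) - (8 + 15 * t) * ((42 + 72 * t) * val t 1 (Suc (Suc q)))"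
    by (simp add: algebra_simps)
  also have "\<dots> = 9 * ((8 + 9 * t) * val t 0 (Suc q) - (8 + 15 * t) * val t 0 (Suc (Suc q)))
      + 8 * ((8 + 9 * t) * val t 1 q - (8 + 15 * t) * val t 1 (Suc q))
      + 25 * ((8 + 9 * t) * val t 0 q - (8 + 15 * t) * val t 0 (Suc q))"
    using val_column_1_mult[OF t, of "Suc q"] val_column_1_mult[OF t, of "Suc (Suc q)"] step(1)
    by (simp add: algebra_simps)
  also have "0 < \<dots>"
    using step edge_growth[OF t, of q] edge_growth[OF t, of "Suc q"] by (simp add: val_edge)
  finally show ?case using t by (simp add: zero_less_mult_iff)
qed

lemma one_step:
  assumes t: "0 < t" and pq: "2 \<le> p" "1 \<le> q"
  shows "2 * val t (p - 1) q < (2 + 3 * t) * val t p q"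
proof -
  \<comment> \<open>At \<open>p = 2\<close> the two values obey different recursions, one of the
    interior and one of column 1, so this case needs its own induction. The term left over by the
    interior recursion is the one bounded in \<open>column_1_growth\<close>.\<close>
  have column: "2 * val t 1 q < (2 + 3 * t) * val t 2 q" if "2 \<le> q" for q
    using that
  proof (induction q rule: dec_induct)
    case base
    then show ?case using one_step_2_2[OF t] val_commute[of t 1 2] by simp
  next
    case (step q)
    have "(5 + 9 * t) * ((2 + 3 * t) * val t 2 (Suc q) - 2 * val t 1 (Suc q))
        = (2 + 3 * t) * ((5 + 9 * t) * val t 2 (Suc q)) - 2 * (5 + 9 * t) * val t 1 (Suc q)"
      by (simp add: algebra_simps)
    also have "\<dots> = ((2 + 3 * t) * val t 2 q - 2 * val t 1 q)
        + ((8 + 9 * t) * val t 1 q - (8 + 15 * t) * val t 1 (Suc q))"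
      using val_inner_mult[OF t, of 2 "Suc q"] step(1) by (simp add: algebra_simps)
    also have "0 < \<dots>" using step column_1_growth[OF t step(1)] by simp
    finally show ?case using t by (simp add: zero_less_mult_iff)
  qed
  have "0 < (\<Sum>i\<le>1::nat. (if i = 0 then 2 + 3 * t else - 2) * val t (p - i) q)"
  proof (rule shift_combination_pos[OF t, where k = 2])
    show "0 \<le> (\<Sum>i\<le>1::nat. (if i = 0 then 2 + 3 * t else - 2) * val t (p - i) 0)" if "2 \<le> p" for p
      using edge_one_step(1)[OF t that] by (simp add: val_edge)
    show "0 < (\<Sum>i\<le>1::nat. (if i = 0 then 2 + 3 * t else - 2) * val t (p - i) q)"
      if "2 \<le> p" "1 \<le> q" "q \<le> 2" "p < 1 + 3" for p q
    proof -
      have "(p = 2 \<or> p = 3) \<and> (q = 1 \<or> q = 2)" using that by auto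
      then show ?thesis
        using one_step_2_1[OF t] one_step_2_2[OF t] one_step_3_1[OF t] one_step_3_2[OF t]
          val_commute[of t 1 2]
        by auto
    qed
    show "0 < (\<Sum>i\<le>1::nat. (if i = 0 then 2 + 3 * t else - 2) * val t (p - i) q)"
      if "2 \<le> p" "3 \<le> q" "p < 1 + 2" for p q
      using column[of q] that by (cases "p = 2") auto
  qed (use pq in auto)
  then show ?thesis by simp
qed

lemma one_step_last:
  assumes t: "0 < t" and q: "1 \<le> q"
  shows "3 * val t 0 q < (3 + 4 * t) * val t 1 q"
proof (cases "q = 1")
  case True
  then show ?thesis using one_step_1_1[OF t] by simp
next
  case False
  then have "2 \<le> q" using q by simp
  then show ?thesis
  proof (induction q rule: dec_induct)
    case base
    then show ?case using one_step_1_2[OF t] val_commute[of t 1 2] by simp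
  next
    case (step q)
    let ?u = "edge_val t q" and ?v = "edge_val t (Suc q)"
    \<comment> \<open>These coefficients are what the recursion of column 1 leaves on the edge: 99 +
      180 t = 3 (42 + 72 t) - 9 (3 + 4 t) and 99 + 100 t = 25 (3 + 4 t) + 24.\<close>
    have "(99 + 180 * t) * ((2 + 3 * t) * ?v) \<le> (99 + 180 * t) * ((2 + t) * ?u)"
      using edge_val_upper[OF t, of "Suc q"] step(1) t by (intro mult_left_mono) auto
    also have "\<dots> = ((2 + 3 * t) * (99 + 100 * t) - t * (38 + 120 * t)) * ?u"
      by (simp add: algebra_simps)
    also have "\<dots> \<le> (2 + 3 * t) * (99 + 100 * t) * ?u"
      using t edge_val_pos[OF t, of q] by (intro mult_right_mono) auto
    finally have "(2 + 3 * t) * ((99 + 180 * t) * ?v) \<le> (2 + 3 * t) * ((99 + 100 * t) * ?u)"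
      by (simp add: mult_ac)
    then have edge: "(99 + 180 * t) * ?v \<le> (99 + 100 * t) * ?u"
      using t by (simp only: mult_le_cancel_left_pos add_pos_pos mult_pos_pos zero_less_numeral)
    have "(42 + 72 * t) * ((3 + 4 * t) * val t 1 (Suc q) - 3 * val t 0 (Suc q))
        = (3 + 4 * t) * ((42 + 72 * t) * val t 1 (Suc q)) - 3 * (42 + 72 * t) * val t 0 (Suc q)"
      by (simp add: algebra_simps)
    also have "\<dots> = 8 * ((3 + 4 * t) * val t 1 q - 3 * val t 0 q) + ((99 + 100 * t) * ?u - (99 + 180 * t) * ?v)"
      using val_column_1_mult[OF t, of "Suc q"] step(1) by (simp add: val_edge algebra_simps)
    also have "0 < \<dots>" using step edge by simp
    finally show ?case using t by (simp add: zero_less_mult_iff)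
  qed
qed

lemma edge_decreasing:
  assumes t: "0 < t" and p: "1 \<le> p"
  shows "edge_val t p < edge_val t (p - 1)"
proof -
  consider "p = 1" | "p = 2" | "3 \<le> p" using p by linarith
  then show ?thesis
  proof cases
    case 1
    then show ?thesis using t edge_val_0[OF t] edge_val_1[OF t] by simp
  next
    case 2
    have "edge_val t 1 - edge_val t 2 = 51 * t / (2 * (3 + 4 * t) * (11 + 18 * t))"
      unfolding edge_val_1[OF t] edge_val_2[OF t] using t
      by (simp add: divide_simps) (simp add: algebra_simps)
    also have "0 < \<dots>" using t by simp
    finally show ?thesis using 2 by simp
  next
    case 3
    have "(2 + t) * edge_val t p < (2 + 3 * t) * edge_val t p"
      using t edge_val_pos[OF t, of p] by (intro mult_strict_right_mono) auto
    also have "\<dots> \<le> (2 + t) * edge_val t (p - 1)" by (rule edge_val_upper[OF t 3])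
    finally show ?thesis using t by (simp only: mult_less_cancel_left_pos add_pos_pos zero_less_numeral)
  qed
qed

text \<open>Needed for \<open>Atilde\<close>, which moves away from the target, for
  \<open>A12'\<close>, and for the upper bound on column 1 in \<open>two_step_aux\<close>. In
  columns 0 and 1 the neighbouring column obeys another recursion; the one-step inequality prevents
  the larger value from dropping too fast.\<close>

lemma val_decreasing:
  assumes t: "0 < t" and pq: "1 \<le> p" "1 \<le> q"
  shows "val t p q < val t (p - 1) q"
proof -
  have column_0: "val t 1 q < val t 0 q" if "2 \<le> q" for q
    using that
  proof (induction q rule: dec_induct)
    case base
    then show ?case using decreasing_0_2[OF t] val_commute[of t 1 2] by simp
  next
    case (step q)
    let ?u = "val t 0 q" and ?v = "val t 0 (Suc q)"
    have edge: "2 * ?u \<le> (2 + 3 * t) * ?v"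
      using edge_one_step(1)[OF t, of "Suc q"] step(1) by (simp add: val_edge)
    have "(42 + 72 * t) * (?v - val t 1 (Suc q)) = (42 + 72 * t) * ?v - (42 + 72 * t) * val t 1 (Suc q)"
      by (simp add: algebra_simps)
    \<comment> \<open>The weight 33/2 is chosen to cancel the edge value at q: the recursion
      contributes 8 + 25 = 33 copies of it.\<close>
    also have "\<dots> = 8 * (?u - val t 1 q) + 33 / 2 * ((2 + 3 * t) * ?v - 2 * ?u) + 45 / 2 * t * ?v"
      using val_column_1_mult[OF t, of "Suc q"] step(1) by (simp add: algebra_simps)
    also have "0 < \<dots>"
      using step.IH edge t val_pos[OF t, of 0 "Suc q"]
      by (intro add_pos_pos[OF add_pos_nonneg]) (auto simp: mult.commute)
    finally show ?case using t by (simp add: zero_less_mult_iff)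
  qed
  have column_1: "val t 2 q < val t 1 q" if "2 \<le> q" for q
    using that
  proof (induction q rule: dec_induct)
    case base
    then show ?case using decreasing_1_2[OF t] val_commute[of t 1 2] by simp
  next
    case (step q)
    have one: "2 * val t 1 q < (2 + 3 * t) * val t 1 (Suc q)"
      using one_step[OF t, of "Suc q" 1] step(1) val_commute[of t 1 q] val_commute[of t 1 "Suc q"] by simp
    have "(5 + 9 * t) * (val t 1 (Suc q) - val t 2 (Suc q))
        = (5 + 9 * t) * val t 1 (Suc q) - (5 + 9 * t) * val t 2 (Suc q)"
      by (simp add: algebra_simps)
    also have "\<dots> = (val t 1 q - val t 2 q) + 2 * ((2 + 3 * t) * val t 1 (Suc q) - 2 * val t 1 q)
        + 3 * t * val t 1 (Suc q)"
      using val_inner_mult[OF t, of 2 "Suc q"] step(1) by (simp add: algebra_simps)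
    also have "0 < \<dots>"
      using step one t val_pos[OF t, of 1 "Suc q"] by (intro add_pos_pos) (auto simp: mult.commute)
    finally show ?case using t by (simp add: zero_less_mult_iff)
  qed
  have "0 < (\<Sum>i\<le>1::nat. (if i = 0 then - 1 else 1) * val t (p - i) q)"
  proof (rule shift_combination_pos[OF t, where k = 1])
    show "0 \<le> (\<Sum>i\<le>1::nat. (if i = 0 then - 1 else 1) * val t (p - i) 0)" if "1 \<le> p" for p
      using edge_decreasing[OF t that] by (simp add: val_edge)
    show "0 < (\<Sum>i\<le>1::nat. (if i = 0 then - 1 else 1) * val t (p - i) q)"
      if "1 \<le> p" "1 \<le> q" "q \<le> 2" "p < 1 + 3" for p q
    proof -
      have "(p = 1 \<or> p = 2 \<or> p = 3) \<and> (q = 1 \<or> q = 2)" using that by auto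
      then show ?thesis
        using decreasing_0_1[OF t] decreasing_1_1[OF t] decreasing_2_1[OF t]
          decreasing_0_2[OF t] decreasing_1_2[OF t] decreasing_2_2[OF t] val_commute[of t 1 2]
        by auto
    qed
    show "0 < (\<Sum>i\<le>1::nat. (if i = 0 then - 1 else 1) * val t (p - i) q)"
      if "1 \<le> p" "3 \<le> q" "p < 1 + 2" for p q
    proof -
      have "p = 1 \<or> p = 2" using that by auto
      then show ?thesis using column_0[of q] column_1[of q] that by auto
    qed
  qed (use pq in auto)
  then show ?thesis by simp
qed

text \<open>
  This is the increment of \<open>(88 + 144 t) val t 2 q - 31 val t 1 q - 57 val t 0 q\<close> from \<open>q\<close> to \<open>q + 1\<close>
  after clearing denominators, with \<open>u'\<close>, \<open>u\<close>, \<open>w\<close> three consecutive values in column \<open>0\<close> and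
  \<open>x'\<close>, \<open>x\<close> two in column \<open>1\<close>. Both possible recursions for \<open>w\<close> have to be treated.
\<close>
lemma two_step_last_aux:
  fixes t :: real
  assumes t: "0 < t" and u': "0 < u'"
    and u: "(2 + 3 * t) * u \<le> (2 + t) * u'"
    and w: "(2 + 3 * t) * w = 2 * u \<or> (12 + 27 * t) * w = 7 * u + 5 * u'"
    and x: "(42 + 72 * t) * x = 9 * u + 8 * x' + 25 * u'"
    and x': "3 * u' < (3 + 4 * t) * x'"
  shows "0 < (11854 + 38304 * t + 31104 * t ^ 2) * x + (719 + 729 * t) * u
      - (12573 + 43281 * t + 36936 * t ^ 2) * w" (is "0 < ?X * x + ?V * u - ?Y * w")
  using w
proof
  assume w: "(2 + 3 * t) * w = 2 * u"
  have "(2 + 3 * t) ^ 2 * (3 + 4 * t) * (42 + 72 * t) * (?X * x + ?V * u - ?Y * w)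
      = (2 + 3 * t) ^ 2 * (3 + 4 * t) * ?X * ((42 + 72 * t) * x)
        + (2 + 3 * t) * (3 + 4 * t) * (42 + 72 * t) * ((2 + 3 * t) * ?V * u - ?Y * ((2 + 3 * t) * w))"
    by (simp add: algebra_simps power2_eq_square)
  \<comment> \<open>A positivity certificate: \<open>x\<close> is traded for \<open>x'\<close> by
    its recursion, \<open>w\<close> for \<open>u\<close> by its own, and the rest is a nonnegative
    combination of the slacks in the hypotheses plus a positive multiple of \<open>u'\<close>. The
    other regime below works in the same way.\<close>
  also have "\<dots> = 8 * (2 + 3 * t) ^ 2 * ?X * ((3 + 4 * t) * x' - 3 * u')
      + (2347092 + 15673116 * t + 38891502 * t ^ 2 + 42520032 * t ^ 3 + 17286048 * t ^ 4)
        * ((2 + t) * u' - (2 + 3 * t) * u)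
      + (299212 * t + 4474530 * t ^ 2 + 16223850 * t ^ 3 + 22419936 * t ^ 4 + 10707552 * t ^ 5) * u'"
    unfolding x w by (simp add: algebra_simps power_numeral_reduce)
  also have "0 < \<dots>"
    using t u u' x' by (intro add_nonneg_pos add_nonneg_nonneg mult_nonneg_nonneg mult_pos_pos add_pos_pos) auto
  finally show ?thesis
    by (rule zero_less_mult_pos) (use t in \<open>simp add: add_pos_pos\<close>)
next
  assume w: "(12 + 27 * t) * w = 7 * u + 5 * u'"
  have "(2 + 3 * t) * (12 + 27 * t) * (3 + 4 * t) * (42 + 72 * t) * (?X * x + ?V * u - ?Y * w)
      = (2 + 3 * t) * (12 + 27 * t) * (3 + 4 * t) * ?X * ((42 + 72 * t) * x)
        + (2 + 3 * t) * (3 + 4 * t) * (42 + 72 * t) * ((12 + 27 * t) * ?V * u - ?Y * ((12 + 27 * t) * w))"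
    by (simp add: algebra_simps power2_eq_square)
  also have "\<dots> = 8 * (2 + 3 * t) * (12 + 27 * t) * ?X * ((3 + 4 * t) * x' - 3 * u')
      + (6161562 + 38935638 * t + 92414574 * t ^ 2 + 97526592 * t ^ 3 + 38561184 * t ^ 4)
        * ((2 + t) * u' - (2 + 3 * t) * u)
      + (14468856 * t + 81929574 * t ^ 2 + 172325178 * t ^ 3 + 158871456 * t ^ 4 + 53817696 * t ^ 5) * u'"
    unfolding x w by (simp add: algebra_simps power_numeral_reduce)
  also have "0 < \<dots>"
    using t u u' x' by (intro add_nonneg_pos add_nonneg_nonneg mult_nonneg_nonneg mult_pos_pos add_pos_pos) auto
  finally show ?thesis
    by (rule zero_less_mult_pos) (use t in \<open>simp add: add_pos_pos\<close>)
qed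

text \<open>For q = 1 and q = 2 both sides are equal by the definition of the table, so the
  induction starts at the strict inequality for q = 3. Each step adds the increment estimated in
  \<open>two_step_last_aux\<close>.\<close>

lemma two_step_last:
  assumes t: "0 < t" and q: "3 \<le> q"
  shows "31 * val t 1 q + 57 * val t 0 q < (88 + 144 * t) * val t 2 q"
  using q
proof (induction q rule: dec_induct)
  case base
  then show ?case
    using two_step_2_3[OF t] val_commute[of t 1 3] val_commute[of t 2 3] by simp
next
  case (step q)
  let ?u = "val t 0 q" and ?w = "val t 0 (Suc q)" and ?x = "val t 1 q" and ?z = "val t 1 (Suc q)"
    and ?y = "val t 2 q"
  have aux: "0 < (11854 + 38304 * t + 31104 * t ^ 2) * ?x + (719 + 729 * t) * ?u
      - (12573 + 43281 * t + 36936 * t ^ 2) * ?w"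
  proof (rule two_step_last_aux[OF t])
    show "0 < val t 0 (q - 1)" by (rule val_pos[OF t])
    show "(2 + 3 * t) * ?u \<le> (2 + t) * val t 0 (q - 1)"
      using edge_val_upper[OF t step(1)] by (simp add: val_edge)
    show "(2 + 3 * t) * ?w = 2 * ?u \<or> (12 + 27 * t) * ?w = 7 * ?u + 5 * val t 0 (q - 1)"
      using edge_val_rec_cases[OF t, of "Suc q"] step(1) by (simp add: val_edge numeral_2_eq_2)
    show "(42 + 72 * t) * ?x = 9 * ?u + 8 * val t 1 (q - 1) + 25 * val t 0 (q - 1)"
      by (rule val_column_1_mult[OF t step(1)])
    show "3 * val t 0 (q - 1) < (3 + 4 * t) * val t 1 (q - 1)"
      using step(1) by (intro one_step_last[OF t]) auto
  qed
  have z: "(42 + 72 * t) * ?z = 9 * ?w + 8 * ?x + 25 * ?u"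
    using val_column_1_mult[OF t, of "Suc q"] step(1) by simp
  have y: "(5 + 9 * t) * val t 2 (Suc q) = ?z + ?y + 3 * ?x"
    using val_inner_mult[OF t, of 2 "Suc q"] step(1) by simp
  have "(42 + 72 * t) * (5 + 9 * t) * ((88 + 144 * t) * val t 2 (Suc q) - (31 * ?z + 57 * ?w))
      = (42 + 72 * t) * ((88 + 144 * t) * ((5 + 9 * t) * val t 2 (Suc q)) - (5 + 9 * t) * (31 * ?z + 57 * ?w))"
    by (simp add: algebra_simps)
  also have "\<dots> = (42 + 72 * t) * ((88 + 144 * t) * (?y + 3 * ?x) - 57 * (5 + 9 * t) * ?w)
      - (67 + 135 * t) * ((42 + 72 * t) * ?z)"
    unfolding y by (simp add: algebra_simps)
  also have "\<dots> = (42 + 72 * t) * ((88 + 144 * t) * ?y - (31 * ?x + 57 * ?u))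
      + ((11854 + 38304 * t + 31104 * t ^ 2) * ?x + (719 + 729 * t) * ?u
        - (12573 + 43281 * t + 36936 * t ^ 2) * ?w)"
    unfolding z by (simp add: algebra_simps power2_eq_square)
  also have "0 < \<dots>"
    using step.IH t aux by (intro add_pos_pos mult_pos_pos) auto
  finally have "0 < (88 + 144 * t) * val t 2 (Suc q) - (31 * ?z + 57 * ?w)"
    by (rule zero_less_mult_pos) (use t in \<open>simp add: add_pos_pos\<close>)
  then show ?case by simp
qed

text \<open>
  The analogous increment in column \<open>3\<close>. The coefficient of \<open>x\<close> changes sign with \<open>t\<close>, so \<open>x\<close> has to be
  bounded on both sides.
\<close>
lemma two_step_aux:
  fixes t :: real
  assumes t: "0 < t" and u: "0 < u"
    and w: "(2 + 3 * t) * w \<le> (2 + t) * u"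
    and z: "(42 + 72 * t) * z = 9 * w + 8 * x + 25 * u"
    and x: "3 * u \<le> (3 + 4 * t) * x" "x \<le> u"
    and y: "31 * x + 57 * u \<le> (88 + 144 * t) * y"
  shows "0 < (192 + 756 * t + 729 * t ^ 2) * y - (44 + 63 * t) * x - (148 + 486 * t + 405 * t ^ 2) * z"
    (is "0 < ?A * y - ?B * x - ?C * z")
proof -
  \<comment> \<open>These come from the coefficients of \<open>x\<close> and \<open>u\<close> once
    \<open>y\<close> and \<open>w\<close> are replaced by their bounds. The constant terms of
    \<open>2 * ?c + ?d\<close> cancel, so with either bound on \<open>x\<close> only terms divisible
    by t are left; the sign of \<open>?c\<close> decides which bound is used.\<close>
  let ?c = "- 16832 + 122472 * t + 555174 * t ^ 2 + 507384 * t ^ 3"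
  let ?d = "33664 + 1123152 * t + 4924044 * t ^ 2 + 7689006 * t ^ 3 + 4076568 * t ^ 4"
  have "(2 + 3 * t) * (88 + 144 * t) * (42 + 72 * t) * (?A * y - ?B * x - ?C * z)
      = (2 + 3 * t) * (42 + 72 * t) * (?A * ((88 + 144 * t) * y) - (88 + 144 * t) * ?B * x)
        - (2 + 3 * t) * (88 + 144 * t) * ?C * ((42 + 72 * t) * z)"
    by (simp add: algebra_simps power2_eq_square)
  also have "\<dots> = (2 + 3 * t) * (42 + 72 * t) * ?A * ((88 + 144 * t) * y - (31 * x + 57 * u))
      + 9 * (88 + 144 * t) * ?C * ((2 + t) * u - (2 + 3 * t) * w)
      + ((2 + 3 * t) * ?c * x + ?d * u)"
    unfolding z by (simp add: algebra_simps power_numeral_reduce)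
  also have "0 < \<dots>"
  proof (rule add_nonneg_pos)
    show "0 < (2 + 3 * t) * ?c * x + ?d * u"
    proof (cases "0 \<le> ?c")
      case True
      have "(3 + 4 * t) * ((2 + 3 * t) * ?c * x + ?d * u)
          = (2 + 3 * t) * ?c * ((3 + 4 * t) * x - 3 * u)
            + (4087456 * t + 23698032 * t ^ 2 + 50804064 * t ^ 3 + 47552184 * t ^ 4 + 16306272 * t ^ 5) * u"
        by (simp add: algebra_simps power_numeral_reduce)
      also have "0 < \<dots>"
        using t u x(1) True by (intro add_nonneg_pos mult_nonneg_nonneg mult_pos_pos add_pos_pos) auto
      finally show ?thesis
        by (rule zero_less_mult_pos) (use t in simp)
    next
      case False
      have "(2 + 3 * t) * ?c * x + ?d * u
          = (2 + 3 * t) * (- ?c) * (u - x)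
            + (1317600 * t + 6401808 * t ^ 2 + 10369296 * t ^ 3 + 5598720 * t ^ 4) * u"
        by (simp add: algebra_simps power_numeral_reduce)
      also have "0 < \<dots>"
        using t u x(2) False by (intro add_nonneg_pos mult_nonneg_nonneg mult_pos_pos add_pos_pos) auto
      finally show ?thesis .
    qed
    show "0 \<le> (2 + 3 * t) * (42 + 72 * t) * ?A * ((88 + 144 * t) * y - (31 * x + 57 * u))
        + 9 * (88 + 144 * t) * ?C * ((2 + t) * u - (2 + 3 * t) * w)"
      using t w y by (intro add_nonneg_nonneg mult_nonneg_nonneg) auto
  qed
  finally show ?thesis
    by (rule zero_less_mult_pos) (use t in \<open>simp add: add_pos_pos\<close>)
qed

lemma two_step_4_1:
  assumes t: "0 < t"
  shows "7 * val t 3 1 + 5 * val t 2 1 < (12 + 27 * t) * val t 4 1"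
proof -
  have rec: "(42 + 72 * t) * val t 4 1 = 9 * val t 4 0 + 8 * val t 3 1 + 25 * val t 3 0"
    using val_row_1_mult[OF t, of 4] by simp
  \<comment> \<open>The one-step move bounds the edge value at index 4 from below whichever rule
    defines it.\<close>
  have "2 * val t 3 0 / (2 + 3 * t) \<le> val t 4 0"
    using edge_one_step(1)[OF t, of 4] t by (simp add: val_edge divide_le_eq mult.commute)
  then have "18 * val t 3 0 / (2 + 3 * t) + 8 * val t 3 1 + 25 * val t 3 0 \<le> (42 + 72 * t) * val t 4 1"
    unfolding rec by simp
  then have "(12 + 27 * t) * (18 * val t 3 0 / (2 + 3 * t) + 8 * val t 3 1 + 25 * val t 3 0)
      \<le> (12 + 27 * t) * ((42 + 72 * t) * val t 4 1)"
    using t by (intro mult_left_mono) auto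
  with two_step_4_1_aux[OF t]
  have "(42 + 72 * t) * (7 * val t 3 1 + 5 * val t 2 1) < (12 + 27 * t) * ((42 + 72 * t) * val t 4 1)"
    by linarith
  also have "\<dots> = (42 + 72 * t) * ((12 + 27 * t) * val t 4 1)"
    by (rule mult.left_commute)
  finally show ?thesis
    using t by (simp only: mult_less_cancel_left_pos add_pos_pos mult_pos_pos zero_less_numeral)
qed

lemma two_step_4_2:
  assumes t: "0 < t"
  shows "7 * val t 3 2 + 5 * val t 2 2 < (12 + 27 * t) * val t 4 2"
proof -
  have rec: "(5 + 9 * t) * val t 4 2 = val t 3 2 + val t 4 1 + 3 * val t 3 1"
    "(5 + 9 * t) * val t 3 2 = val t 2 2 + val t 3 1 + 3 * val t 2 1"
    using val_inner_mult[OF t, of 4 2] val_inner_mult[OF t, of 3 2] by simp_all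
  have "(5 + 9 * t) * (7 * val t 3 2 + 5 * val t 2 2)
      = 7 * ((5 + 9 * t) * val t 3 2) + 5 * (5 + 9 * t) * val t 2 2"
    by (simp add: algebra_simps)
  also have "\<dots> < (12 + 27 * t) * (val t 3 2 + 3 * val t 3 1) + (12 + 27 * t) * val t 4 1"
    unfolding rec using two_step_4_1[OF t] two_step_4_2_aux[OF t] by simp
  also have "\<dots> = (12 + 27 * t) * ((5 + 9 * t) * val t 4 2)"
    unfolding rec by (simp add: algebra_simps)
  also have "\<dots> = (5 + 9 * t) * ((12 + 27 * t) * val t 4 2)"
    by (rule mult.left_commute)
  finally show ?thesis
    using t by (simp only: mult_less_cancel_left_pos add_pos_pos mult_pos_pos zero_less_numeral)
qed

lemma two_step:
  assumes t: "0 < t" and pq: "3 \<le> p" "1 \<le> q"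
  shows "7 * val t (p - 1) q + 5 * val t (p - 2) q < (12 + 27 * t) * val t p q"
proof -
  \<comment> \<open>Two shifts from index 3 end in column 1, outside the interior recursion, so
    \<open>p = 3\<close> is again an induction on q.\<close>
  have column: "7 * val t 2 q + 5 * val t 1 q < (12 + 27 * t) * val t 3 q" if "2 \<le> q" for q
    using that
  proof (induction q rule: dec_induct)
    case base
    then show ?case using two_step_3_2[OF t] val_commute[of t 1 2] by simp
  next
    case (step q)
    let ?x = "val t 1 q" and ?y = "val t 2 q" and ?z = "val t 1 (Suc q)"
    have aux: "0 < (192 + 756 * t + 729 * t ^ 2) * ?y - (44 + 63 * t) * ?x - (148 + 486 * t + 405 * t ^ 2) * ?z"
    proof (rule two_step_aux[OF t])
      show "0 < val t 0 q" by (rule val_pos[OF t])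
      show "(2 + 3 * t) * val t 0 (Suc q) \<le> (2 + t) * val t 0 q"
        using edge_val_upper[OF t, of "Suc q"] step(1) by (simp add: val_edge)
      show "(42 + 72 * t) * ?z = 9 * val t 0 (Suc q) + 8 * ?x + 25 * val t 0 q"
        using val_column_1_mult[OF t, of "Suc q"] step(1) by simp
      show "3 * val t 0 q \<le> (3 + 4 * t) * ?x" using one_step_last[OF t, of q] step(1) by simp
      show "?x \<le> val t 0 q" using val_decreasing[OF t, of 1 q] step(1) by simp
      show "31 * ?x + 57 * val t 0 q \<le> (88 + 144 * t) * ?y"
        using val_2_mult[OF t, of q] two_step_last[OF t, of q] step(1) by (cases "q = 2") auto
    qed
    have y: "(5 + 9 * t) * val t 2 (Suc q) = ?z + ?y + 3 * ?x"
      using val_inner_mult[OF t, of 2 "Suc q"] step(1) by simp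
    have r: "(5 + 9 * t) * val t 3 (Suc q) = val t 2 (Suc q) + val t 3 q + 3 * ?y"
      using val_inner_mult[OF t, of 3 "Suc q"] step(1) by simp
    \<comment> \<open>One factor serves to unfold \<open>val t 3 (Suc q)\<close>, the other the
      \<open>val t 2 (Suc q)\<close> inside it. The previous instance of the inequality splits off,
      and the rest is \<open>aux\<close>.\<close>
    have "(5 + 9 * t) ^ 2 * ((12 + 27 * t) * val t 3 (Suc q) - (7 * val t 2 (Suc q) + 5 * ?z))
        = (5 + 9 * t) * ((12 + 27 * t) * ((5 + 9 * t) * val t 3 (Suc q)) - 5 * (5 + 9 * t) * ?z)
          - 7 * (5 + 9 * t) * ((5 + 9 * t) * val t 2 (Suc q))"
      by (simp add: algebra_simps power2_eq_square)
    also have "\<dots> = (5 + 9 * t) * ((12 + 27 * t) * (val t 3 q + 3 * ?y) - 5 * (5 + 9 * t) * ?z)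
        - (23 + 36 * t) * ((5 + 9 * t) * val t 2 (Suc q))"
      unfolding r by (simp add: algebra_simps)
    also have "\<dots> = (5 + 9 * t) * ((12 + 27 * t) * val t 3 q - (7 * ?y + 5 * ?x))
        + ((192 + 756 * t + 729 * t ^ 2) * ?y - (44 + 63 * t) * ?x - (148 + 486 * t + 405 * t ^ 2) * ?z)"
      unfolding y by (simp add: algebra_simps power2_eq_square)
    also have "0 < \<dots>"
      using step.IH t aux by (intro add_pos_pos mult_pos_pos) auto
    finally have "0 < (12 + 27 * t) * val t 3 (Suc q) - (7 * val t 2 (Suc q) + 5 * ?z)"
      by (rule zero_less_mult_pos) (use t in simp)
    then show ?case by simp
  qed
  let ?c = "\<lambda>i::nat. if i = 0 then 12 + 27 * t else if i = 1 then - 7 else - 5"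
  have sum_eq: "(\<Sum>i\<le>2::nat. ?c i * val t (p - i) q)
      = (12 + 27 * t) * val t p q - (7 * val t (p - 1) q + 5 * val t (p - 2) q)" for p q
    by (simp add: numeral_2_eq_2)
  have "0 < (\<Sum>i\<le>2::nat. ?c i * val t (p - i) q)"
  proof (rule shift_combination_pos[OF t, where k = 3])
    show "0 \<le> (\<Sum>i\<le>2::nat. ?c i * val t (p - i) 0)" if "3 \<le> p" for p
      unfolding sum_eq using edge_two_step(1)[OF t that] by (simp add: val_edge)
    show "0 < (\<Sum>i\<le>2::nat. ?c i * val t (p - i) q)"
      if "3 \<le> p" "1 \<le> q" "q \<le> 2" "p < 2 + 3" for p q
    proof -
      have "(p = 3 \<or> p = 4) \<and> (q = 1 \<or> q = 2)" using that by auto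
      then show ?thesis
        unfolding sum_eq
        using two_step_3_1[OF t] two_step_4_1[OF t] column[of 2] two_step_4_2[OF t]
        by auto
    qed
    show "0 < (\<Sum>i\<le>2::nat. ?c i * val t (p - i) q)"
      if "3 \<le> p" "3 \<le> q" "p < 2 + 2" for p q
    proof -
      have p: "p = 3" using that by auto
      show ?thesis unfolding sum_eq p using column[of q] that by simp
    qed
  qed (use pq in auto)
  then show ?thesis unfolding sum_eq by simp
qed

section \<open>Bellman gaps of the auxiliary MDP\<close>

definition coord :: "nat \<Rightarrow> nat \<Rightarrow> nat" where
  "coord N p = (if p = 0 then N else N - 1 - p)"

definition index :: "nat \<Rightarrow> nat \<Rightarrow> nat" where
  "index N i = (if i = N then 0 else N - 1 - i)"

text \<open>The factor (1 + t) / t is 1 / (1 - \<open>lam\<close>), the value of collecting reward 1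
  forever at the target, where \<open>val\<close> is 1. The origin is absorbing and without reward;
  the value 0 outside the state space keeps the function bounded.\<close>

definition opt_value :: "nat \<Rightarrow> real \<Rightarrow> state \<Rightarrow> real" where
  "opt_value N t s = (if s \<in> hat_S N - {(0, 0)}
     then (1 + t) / t * val t (index N (fst s)) (index N (snd s)) else 0)"

lemma index_coord: "6 \<le> N \<Longrightarrow> p \<le> N - 3 \<Longrightarrow> index N (coord N p) = p"
  by (auto simp: index_def coord_def)

lemma hat_S_eq_coord:
  assumes "6 \<le> N"
  shows "hat_S N - {(0, 0)} = (\<lambda>(p, q). (coord N p, coord N q)) ` ({..N - 3} \<times> {..N - 3})"
proof -
  have "{2..N-2} \<union> {N} = coord N ` {..N - 3}"
  proof (intro equalityI subsetI)
    fix i assume "i \<in> {2..N-2} \<union> {N}"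
    then have "i = coord N (index N i)" "index N i \<le> N - 3"
      using assms by (auto simp: index_def coord_def)
    then show "i \<in> coord N ` {..N - 3}" by blast
  qed (use assms in \<open>auto simp: coord_def\<close>)
  moreover have "hat_S N - {(0, 0)} = ({2..N-2} \<union> {N}) \<times> ({2..N-2} \<union> {N})"
    using assms by (auto simp: hat_S_def)
  ultimately show ?thesis by (auto simp: image_iff)
qed

lemma opt_value_coord:
  assumes "6 \<le> N" "p \<le> N - 3" "q \<le> N - 3"
  shows "opt_value N t (coord N p, coord N q) = (1 + t) / t * val t p q"
proof -
  have "(coord N p, coord N q) \<in> hat_S N - {(0, 0)}"
    using assms by (auto simp: hat_S_eq_coord)
  then show ?thesis using assms by (simp add: opt_value_def index_coord)
qed

lemma opt_value_swap: "opt_value N t (i, j) = opt_value N t (j, i)"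
  by (auto simp: opt_value_def hat_S_def val_commute)

lemma coord_0: "coord N 0 = N"
  by (simp add: coord_def)

lemma coord_1: "coord N 1 = N - 2"
  by (simp add: coord_def)

lemma coord_inner:
  assumes "6 \<le> N" "2 \<le> p" "p \<le> N - 3"
  shows "coord N p \<in> {2..N - 3}" "coord N p \<noteq> N - 2" "coord N (p - 1) = coord N p + 1"
  using assms by (auto simp: coord_def)

lemma law_1_coord:
  assumes "6 \<le> N" "1 \<le> q" "q \<le> N - 3"
  shows "law_1 N (coord N q) = (if q = 1 then [(coord N 1, 1/4), (coord N 0, 3/4)]
    else [(coord N q, 1/3), (coord N (q - 1), 2/3)])"
proof (cases "q = 1")
  case False
  then show ?thesis using coord_inner[OF assms(1), of q] assms by (auto simp: law_1_def)
qed (use assms in \<open>auto simp: law_1_def coord_def\<close>)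

lemma law_1'_coord:
  assumes "6 \<le> N" "1 \<le> q" "q \<le> N - 3"
  shows "law_1' N (coord N q) = (if q = 1 then [(coord N 1, 1/3), (coord N 0, 2/3)]
    else [(coord N q, 1/2), (coord N (q - 1), 1/2)])"
proof (cases "q = 1")
  case False
  then show ?thesis using coord_inner[OF assms(1), of q] assms by (auto simp: law_1'_def)
qed (use assms in \<open>auto simp: law_1'_def coord_def\<close>)

lemma law_2_coord:
  assumes "6 \<le> N" "2 \<le> q" "q \<le> N - 3"
  shows "law_2 N (coord N q) = (if q = 2 then [(coord N 2, 7/18), (coord N 1, 31/144), (coord N 0, 19/48)]
    else [(coord N q, 5/9), (coord N (q - 1), 7/27), (coord N (q - 2), 5/27)])"
  using assms by (auto simp: law_2_def coord_def)

lemma law_2'_coord: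
  assumes "6 \<le> N" "2 \<le> q" "q \<le> N - 3"
  shows "law_2' N (coord N q) = (if q = 2 then [(coord N 2, 4/9), (coord N 1, 5/27), (coord N 0, 10/27)]
    else [(coord N q, 5/8), (coord N (q - 1), 1/4), (coord N (q - 2), 1/8)])"
  using assms by (auto simp: law_2'_def coord_def)

lemma hat_law_A0_coord:
  assumes N: "6 \<le> N"
  shows "2 \<le> p \<Longrightarrow> p \<le> N - 3 \<Longrightarrow> 2 \<le> q \<Longrightarrow> q \<le> N - 3 \<Longrightarrow> hat_law N (coord N p, coord N q) A0 =
      [((coord N p, coord N q), 4/9), ((coord N (p - 1), coord N q), 1/9),
        ((coord N p, coord N (q - 1)), 1/9), ((coord N (p - 1), coord N (q - 1)), 1/3)]"
    and "2 \<le> p \<Longrightarrow> p \<le> N - 3 \<Longrightarrow> hat_law N (coord N p, coord N 1) A0 =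
      [((coord N p, coord N 1), 5/12), ((coord N p, coord N 0), 1/8),
        ((coord N (p - 1), coord N 1), 1/9), ((coord N (p - 1), coord N 0), 25/72)]"
    and "2 \<le> q \<Longrightarrow> q \<le> N - 3 \<Longrightarrow> hat_law N (coord N 1, coord N q) A0 =
      [((coord N 1, coord N q), 5/12), ((coord N 0, coord N q), 1/8),
        ((coord N 1, coord N (q - 1)), 1/9), ((coord N 0, coord N (q - 1)), 25/72)]"
    and "hat_law N (coord N 1, coord N 1) A0 =
      [((coord N 1, coord N 1), 7/18), ((coord N 0, coord N 1), 1/8),
        ((coord N 1, coord N 0), 1/8), ((coord N 0, coord N 0), 13/36)]"
proof -
  have out: "N - 2 \<notin> {2..N - 3}" using N by auto
  note c = coord_inner[OF N] coord_0 coord_1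
  show "hat_law N (coord N p, coord N q) A0 =
      [((coord N p, coord N q), 4/9), ((coord N (p - 1), coord N q), 1/9),
        ((coord N p, coord N (q - 1)), 1/9), ((coord N (p - 1), coord N (q - 1)), 1/3)]"
    if "2 \<le> p" "p \<le> N - 3" "2 \<le> q" "q \<le> N - 3"
    using c(1,3)[of p] c(1,3)[of q] that by (simp del: atLeastAtMost_iff)
  show "hat_law N (coord N p, coord N 1) A0 =
      [((coord N p, coord N 1), 5/12), ((coord N p, coord N 0), 1/8),
        ((coord N (p - 1), coord N 1), 1/9), ((coord N (p - 1), coord N 0), 25/72)]"
    if "2 \<le> p" "p \<le> N - 3"
    unfolding coord_1 coord_0 using c(1,3)[of p] out that by (simp del: atLeastAtMost_iff)
  show "hat_law N (coord N 1, coord N q) A0 =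
      [((coord N 1, coord N q), 5/12), ((coord N 0, coord N q), 1/8),
        ((coord N 1, coord N (q - 1)), 1/9), ((coord N 0, coord N (q - 1)), 25/72)]"
    if "2 \<le> q" "q \<le> N - 3"
    unfolding coord_1 coord_0 using c(1,2,3)[of q] out that by (simp del: atLeastAtMost_iff)
  show "hat_law N (coord N 1, coord N 1) A0 =
      [((coord N 1, coord N 1), 7/18), ((coord N 0, coord N 1), 1/8),
        ((coord N 1, coord N 0), 1/8), ((coord N 0, coord N 0), 13/36)]"
    unfolding coord_1 coord_0 using out by (simp del: atLeastAtMost_iff)
qed

definition gap :: "nat \<Rightarrow> real \<Rightarrow> nat \<Rightarrow> nat \<Rightarrow> action \<Rightarrow> real" where
  "gap N t p q a =
    bellman_gap (hat_P N) (hat_r N) (1 / (1 + t)) (opt_value N t) (coord N p, coord N q) a"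

lemma expectation_hat_P:
  "measure_pmf.expectation (hat_P N s a) f = (\<Sum>(x, w)\<leftarrow>hat_law N s a. w * f x)"
  unfolding hat_P_def by (rule expectation_pmf_of_list[OF pmf_of_list_wf_hat_law])

lemma gap_eq:
  assumes "6 \<le> N" "p \<le> N - 3" "q \<le> N - 3" "p \<noteq> 0 \<or> q \<noteq> 0"
  shows "gap N t p q a = (1 + t) / t * val t p q
    - 1 / (1 + t) * (\<Sum>(x, w)\<leftarrow>hat_law N (coord N p, coord N q) a. w * opt_value N t x)"
proof -
  have "(coord N p, coord N q) \<noteq> (N, N)"
    using assms by (auto simp: coord_def)
  then show ?thesis
    using assms by (simp add: gap_def bellman_gap_def expectation_hat_P opt_value_coord hat_r_def)
qed

text \<open>Exchanging the coordinates preserves \<open>opt_value\<close> and the reward, so only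
  the transition laws have to match. This reduces the actions on the first coordinate to those on
  the second.\<close>

lemma gap_swap:
  assumes "hat_law N (coord N p, coord N q) a
      = map (\<lambda>((i, j), w). ((j, i), w)) (hat_law N (coord N q, coord N p) b)"
  shows "gap N t p q a = gap N t q p b"
proof -
  have "(\<Sum>(x, w)\<leftarrow>map (\<lambda>((i, j), w). ((j, i), w)) xs. w * opt_value N t x)
      = (\<Sum>(x, w)\<leftarrow>xs. w * opt_value N t x)" for xs
    by (induction xs) (auto simp: opt_value_swap)
  then show ?thesis
    using assms opt_value_swap[of N t "coord N p" "coord N q"]
    by (auto simp: gap_def bellman_gap_def expectation_hat_P hat_r_def)
qed

lemma gap_A2:
  "gap N t p q A21 = gap N t q p A11" "gap N t p q A22 = gap N t q p A12"
  "gap N t p q A21' = gap N t q p A11'" "gap N t p q A22' = gap N t q p A12'"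
  by (rule gap_swap; simp add: move_fst_def move_snd_def split_def)+

section \<open>Gaps as linear combinations of table entries\<close>

context
  fixes N :: nat and t :: real
  assumes N: "6 \<le> N" and t: "0 < t"
begin

lemma diff_le_of_le: "p \<le> m \<Longrightarrow> p - k \<le> m" for p m k :: nat
  by simp

text \<open>Off the target the reward vanishes, and the discount 1 / (1 + t) cancels against the
  factor (1 + t) / t of \<open>opt_value\<close>, leaving only the division by t.\<close>

lemma gap_index:
  assumes "p \<le> N - 3" "q \<le> N - 3" "p \<noteq> 0 \<or> q \<noteq> 0"
    and law: "hat_law N (coord N p, coord N q) a = map (\<lambda>((p', q'), w). ((coord N p', coord N q'), w)) L"
    and L: "\<forall>((p', q'), w)\<in>set L. p' \<le> N - 3 \<and> q' \<le> N - 3"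
  shows "gap N t p q a = ((1 + t) * val t p q - (\<Sum>((p', q'), w)\<leftarrow>L. w * val t p' q')) / t"
proof -
  have "(\<Sum>(x, w)\<leftarrow>map (\<lambda>((p', q'), w). ((coord N p', coord N q'), w)) L. w * opt_value N t x)
      = (1 + t) / t * (\<Sum>((p', q'), w)\<leftarrow>L. w * val t p' q')"
    using L
  proof (induction L)
    case (Cons x L)
    have IH: "(\<Sum>(x, w)\<leftarrow>map (\<lambda>((p', q'), w). ((coord N p', coord N q'), w)) L. w * opt_value N t x)
        = (1 + t) / t * (\<Sum>((p', q'), w)\<leftarrow>L. w * val t p' q')"
      using Cons.prems by (intro Cons.IH) auto
    obtain p' q' w where x: "x = ((p', q'), w)" by (metis prod.collapse)
    then have "p' \<le> N - 3" "q' \<le> N - 3" using Cons.prems by auto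
    then show ?case
      unfolding x list.map sum_list.Cons IH prod.case
      using opt_value_coord[OF N, of p' q' t] by (simp add: algebra_simps)
  qed simp
  then show ?thesis
    unfolding gap_eq[OF N assms(1-3)] law using t by (simp add: diff_divide_distrib)
qed

lemma gap_A11:
  assumes "p \<le> N - 3" "1 \<le> q" "q \<le> N - 3"
  shows "gap N t p q A11 = (if q = 1 then ((3 + 4 * t) * val t p 1 - 3 * val t p 0) / (4 * t)
    else ((2 + 3 * t) * val t p q - 2 * val t p (q - 1)) / (3 * t))"
  using gap_index[of p q A11 "if q = 1 then [((p, 1), 1/4), ((p, 0), 3/4)]
      else [((p, q), 1/3), ((p, q - 1), 2/3)]"] assms N t
  by (simp add: move_snd_def law_1_coord diff_le_of_le split: if_splits) (auto simp: field_simps)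

lemma gap_A11':
  assumes "p \<le> N - 3" "1 \<le> q" "q \<le> N - 3"
  shows "gap N t p q A11' = (if q = 1 then ((2 + 3 * t) * val t p 1 - 2 * val t p 0) / (3 * t)
    else ((1 + 2 * t) * val t p q - val t p (q - 1)) / (2 * t))"
  using gap_index[of p q A11' "if q = 1 then [((p, 1), 1/3), ((p, 0), 2/3)]
      else [((p, q), 1/2), ((p, q - 1), 1/2)]"] assms N t
  by (simp add: move_snd_def law_1'_coord diff_le_of_le split: if_splits) (auto simp: field_simps)

lemma gap_A12:
  assumes "p \<le> N - 3" "2 \<le> q" "q \<le> N - 3"
  shows "gap N t p q A12 =
    (if q = 2 then ((88 + 144 * t) * val t p 2 - (31 * val t p 1 + 57 * val t p 0)) / (144 * t)
     else ((12 + 27 * t) * val t p q - (7 * val t p (q - 1) + 5 * val t p (q - 2))) / (27 * t))"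
  using gap_index[of p q A12 "if q = 2 then [((p, 2), 7/18), ((p, 1), 31/144), ((p, 0), 19/48)]
      else [((p, q), 5/9), ((p, q - 1), 7/27), ((p, q - 2), 5/27)]"] assms N t
  by (simp add: move_snd_def law_2_coord diff_le_of_le split: if_splits) (auto simp: field_simps)

lemma gap_A12':
  assumes "p \<le> N - 3" "2 \<le> q" "q \<le> N - 3"
  shows "gap N t p q A12' =
    (if q = 2 then ((15 + 27 * t) * val t p 2 - (5 * val t p 1 + 10 * val t p 0)) / (27 * t)
     else ((3 + 8 * t) * val t p q - (2 * val t p (q - 1) + val t p (q - 2))) / (8 * t))"
  using gap_index[of p q A12' "if q = 2 then [((p, 2), 4/9), ((p, 1), 5/27), ((p, 0), 10/27)]
      else [((p, q), 5/8), ((p, q - 1), 1/4), ((p, q - 2), 1/8)]"] assms N t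
  by (simp add: move_snd_def law_2'_coord diff_le_of_le split: if_splits) (auto simp: field_simps)

lemma gap_A0:
  assumes "1 \<le> p" "p \<le> N - 3" "1 \<le> q" "q \<le> N - 3"
  shows "gap N t p q A0 =
    (if 2 \<le> p \<and> 2 \<le> q
       then ((5 + 9 * t) * val t p q - (val t (p - 1) q + val t p (q - 1) + 3 * val t (p - 1) (q - 1))) / (9 * t)
     else if 2 \<le> p
       then ((42 + 72 * t) * val t p 1 - (9 * val t p 0 + 8 * val t (p - 1) 1 + 25 * val t (p - 1) 0)) / (72 * t)
     else if 2 \<le> q
       then ((42 + 72 * t) * val t 1 q - (9 * val t 0 q + 8 * val t 1 (q - 1) + 25 * val t 0 (q - 1))) / (72 * t)
     else 0)"
proof -
  consider "2 \<le> p" "2 \<le> q" | "2 \<le> p" "q = 1" | "p = 1" "2 \<le> q" | "p = 1" "q = 1"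
    using assms by linarith
  then show ?thesis
  proof cases
    case 1
    then have "gap N t p q A0 = ((1 + t) * val t p q - (4/9 * val t p q + (1/9 * val t (p - 1) q
        + (1/9 * val t p (q - 1) + 1/3 * val t (p - 1) (q - 1))))) / t"
      using gap_index[of p q A0 "[((p, q), 4/9), ((p - 1, q), 1/9), ((p, q - 1), 1/9), ((p - 1, q - 1), 1/3)]"]
        assms by (simp add: diff_le_of_le hat_law_A0_coord(1)[OF N] del: hat_law.simps)
    with 1 t show ?thesis by (simp add: field_simps)
  next
    case 2
    then have "gap N t p 1 A0 = ((1 + t) * val t p 1 - (5/12 * val t p 1 + (1/8 * val t p 0
        + (1/9 * val t (p - 1) 1 + 25/72 * val t (p - 1) 0)))) / t"
      using gap_index[of p 1 A0 "[((p, 1), 5/12), ((p, 0), 1/8), ((p - 1, 1), 1/9), ((p - 1, 0), 25/72)]"]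
        hat_law_A0_coord(2)[OF N 2(1) assms(2)] assms by (simp add: diff_le_of_le del: hat_law.simps)
    with 2 t show ?thesis by (simp add: field_simps)
  next
    case 3
    then have "gap N t 1 q A0 = ((1 + t) * val t 1 q - (5/12 * val t 1 q + (1/8 * val t 0 q
        + (1/9 * val t 1 (q - 1) + 25/72 * val t 0 (q - 1))))) / t"
      using gap_index[of 1 q A0 "[((1, q), 5/12), ((0, q), 1/8), ((1, q - 1), 1/9), ((0, q - 1), 25/72)]"]
        hat_law_A0_coord(3)[OF N 3(2) assms(4)] assms by (simp add: diff_le_of_le del: hat_law.simps)
    with 3 t show ?thesis by (simp add: field_simps)
  next
    case 4
    then have "gap N t 1 1 A0 = ((1 + t) * val t 1 1 - (7/18 * val t 1 1 + (1/8 * val t 0 1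
        + (1/8 * val t 1 0 + 13/36 * val t 0 0)))) / t"
      using gap_index[of 1 1 A0 "[((1, 1), 7/18), ((0, 1), 1/8), ((1, 0), 1/8), ((0, 0), 13/36)]"]
        hat_law_A0_coord(4)[OF N] assms by (simp add: diff_le_of_le del: hat_law.simps)
    moreover have "(44 + 72 * t) * val t 1 1 = 9 * (val t 0 1 + val t 1 0) + 26 * val t 0 0"
      using val_1_1[of t] t by simp
    ultimately show ?thesis using 4 t by (simp add: field_simps)
  qed
qed

lemma gap_Null:
  assumes "p \<le> N - 3" "q \<le> N - 3" "p \<noteq> 0 \<or> q \<noteq> 0"
  shows "gap N t p q Null = val t p q"
  using gap_index[of p q Null "[((p, q), 1)]"] assms t by (simp add: field_simps)

end

lemma edge_last:
  assumes "0 < t"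
  shows "3 * edge_val t 0 = (3 + 4 * t) * edge_val t 1"
    and "31 * edge_val t 1 + 57 * edge_val t 0 = (88 + 144 * t) * edge_val t 2"
proof -
  have "edge_val t 2 = (31 * edge_val t 1 + 57 * edge_val t 0) / (88 + 144 * t)"
    by (subst edge_val.simps) simp
  then show "31 * edge_val t 1 + 57 * edge_val t 0 = (88 + 144 * t) * edge_val t 2"
    using assms by simp
qed (use assms in \<open>simp add: edge_val_0 edge_val_1[OF assms, simplified] field_simps\<close>)

text \<open>Index \<open>N - 3\<close> is coordinate 2, the side far from the target; there
  \<open>Atilde\<close> may increase an index or, from (2, 2), leave for the origin.\<close>

lemma hat_law_Atilde_coord:
  assumes N: "6 \<le> N" and p: "1 \<le> p" "p \<le> N - 3" and q: "1 \<le> q" "q \<le> N - 3"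
  shows "hat_law N (coord N p, coord N q) Atilde =
    (if p < N - 3 \<and> q < N - 3 then [((coord N p, coord N q), 1)]
     else if q < N - 3 then [((coord N p, coord N q), 1/2), ((coord N p, coord N (q + 1)), 1/2)]
     else if p < N - 3 then [((coord N p, coord N q), 1/2), ((coord N (p + 1), coord N q), 1/2)]
     else [((coord N p, coord N q), 1/3), ((0, 0), 2/3)])"
proof -
  have *: "coord N r \<in> {3..N - 2} \<and> coord N r \<noteq> 2 \<and> coord N (r + 1) = coord N r - 1"
    if "1 \<le> r" "r < N - 3" for r
    using N that by (auto simp: coord_def)
  have **: "coord N (N - 3) = 2" "2 \<notin> {3..N - 2}" using N by (auto simp: coord_def)
  consider "p < N - 3" "q < N - 3" | "p = N - 3" "q < N - 3" | "p < N - 3" "q = N - 3" | "p = N - 3" "q = N - 3"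
    using p q by linarith
  then show ?thesis
  proof cases
    case 1
    then show ?thesis using *[of p] *[of q] p q by (simp del: atLeastAtMost_iff)
  next
    case 2
    then show ?thesis using ** *[of q] q by (simp del: atLeastAtMost_iff)
  next
    case 3
    then show ?thesis using ** *[of p] p by (simp del: atLeastAtMost_iff)
  next
    case 4
    then show ?thesis using ** by (simp del: atLeastAtMost_iff)
  qed
qed

section \<open>Signs of the gaps, action by action\<close>

context
  fixes N :: nat and t :: real
  assumes N: "6 \<le> N" and t: "0 < t"
begin

text \<open>The law of \<open>A11'\<close> mixes the law of \<open>A11\<close> with staying put,
  with weights 3/4 and 1/4, or 8/9 and 1/9 at index 1. Staying has the positive gap
  \<open>val t p q\<close>, so the primed gap is positive as well.\<close>

lemma gap_A11_inner_pos:
  assumes "1 \<le> p" "p \<le> N - 3" "1 \<le> q" "q \<le> N - 3"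
  shows "0 < gap N t p q A11" "0 < gap N t p q A11'"
proof -
  have v: "0 < t * val t p q" using t val_pos[OF t, of p q] by simp
  have "0 < gap N t p q A11 \<and> 0 < gap N t p q A11'"
  proof (cases "q = 1")
    case True
    then show ?thesis
      using one_step_last[OF t assms(1)] val_commute[of t p 1] val_commute[of t p 0] v t assms
      by (simp add: gap_A11[OF N t] gap_A11'[OF N t] algebra_simps)
  next
    case False
    then show ?thesis
      using one_step[OF t, of q p] val_commute[of t p q] val_commute[of t p "q - 1"] v t assms
      by (simp add: gap_A11[OF N t] gap_A11'[OF N t] algebra_simps)
  qed
  then show "0 < gap N t p q A11" "0 < gap N t p q A11'" by auto
qed

lemma gap_A11_edge:
  assumes "1 \<le> q" "q \<le> N - 3"
  shows "0 \<le> gap N t 0 q A11"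
    and "gap N t 0 q A11 = 0 \<longleftrightarrow> q = 1 \<or> q = 3 \<or> (4 \<le> q \<and> t \<le> 2 / 15)"
proof -
  have "0 \<le> gap N t 0 q A11 \<and> (gap N t 0 q A11 = 0 \<longleftrightarrow> q = 1 \<or> q = 3 \<or> (4 \<le> q \<and> t \<le> 2 / 15))"
  proof (cases "q = 1")
    case True
    then show ?thesis
      using edge_last(1)[OF t] t assms by (simp add: gap_A11[OF N t] val_edge)
  next
    case False
    then have "2 \<le> q" using assms by simp
    from edge_one_step[OF t this] show ?thesis
      using False t assms by (auto simp: gap_A11[OF N t] val_edge)
  qed
  then show "0 \<le> gap N t 0 q A11"
    and "gap N t 0 q A11 = 0 \<longleftrightarrow> q = 1 \<or> q = 3 \<or> (4 \<le> q \<and> t \<le> 2 / 15)" by auto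
qed

lemma gap_A12_inner:
  assumes "1 \<le> p" "p \<le> N - 3" "2 \<le> q" "q \<le> N - 3"
  shows "0 \<le> gap N t p q A12" "gap N t p q A12 = 0 \<longleftrightarrow> q = 2 \<and> p \<le> 2"
proof -
  have "0 \<le> gap N t p q A12 \<and> (gap N t p q A12 = 0 \<longleftrightarrow> q = 2 \<and> p \<le> 2)"
  proof (cases "q = 2")
    case True
    then show ?thesis
      using two_step_last[OF t, of p] val_2_mult[OF t assms(1)]
        val_commute[of t p 0] val_commute[of t p 1] val_commute[of t p 2] t assms
      by (cases "p \<le> 2") (simp_all add: gap_A12[OF N t])
  next
    case False
    then have "3 \<le> q" using assms by simp
    from two_step[OF t this assms(1)] show ?thesis
      using val_commute[of t p q] val_commute[of t p "q - 1"] val_commute[of t p "q - 2"] False t assms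
      by (simp add: gap_A12[OF N t])
  qed
  then show "0 \<le> gap N t p q A12" "gap N t p q A12 = 0 \<longleftrightarrow> q = 2 \<and> p \<le> 2" by auto
qed

lemma gap_A12_edge:
  assumes "2 \<le> q" "q \<le> N - 3"
  shows "0 \<le> gap N t 0 q A12"
    and "gap N t 0 q A12 = 0 \<longleftrightarrow> q = 2 \<or> (4 \<le> q \<and> 2 / 15 \<le> t)"
proof -
  have "0 \<le> gap N t 0 q A12 \<and> (gap N t 0 q A12 = 0 \<longleftrightarrow> q = 2 \<or> (4 \<le> q \<and> 2 / 15 \<le> t))"
  proof (cases "q = 2")
    case True
    then show ?thesis
      using edge_last(2)[OF t] t assms by (simp add: gap_A12[OF N t] val_edge)
  next
    case False
    then have "3 \<le> q" using assms by simp
    from edge_two_step[OF t this] show ?thesis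
      using False t assms by (auto simp: gap_A12[OF N t] val_edge)
  qed
  then show "0 \<le> gap N t 0 q A12"
    and "gap N t 0 q A12 = 0 \<longleftrightarrow> q = 2 \<or> (4 \<le> q \<and> 2 / 15 \<le> t)" by auto
qed

text \<open>The forward moves of \<open>A12'\<close> are not in the proportions of
  \<open>A12\<close>, so comparing the two leaves an extra term. Monotonicity of the table controls
  it for q at least 3, and the last one-step inequality for q = 2.\<close>

lemma gap_A12'_inner_pos:
  assumes "1 \<le> p" "p \<le> N - 3" "2 \<le> q" "q \<le> N - 3"
  shows "0 < gap N t p q A12'"
proof (cases "q = 2")
  case True
  let ?u = "val t p 0" and ?x = "val t p 1" and ?y = "val t p 2"
  have u: "0 < ?u" and y: "31 * ?x + 57 * ?u \<le> (88 + 144 * t) * ?y" and x: "3 * ?u < (3 + 4 * t) * ?x"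
    using val_pos[OF t] two_step_last[OF t, of p] val_2_mult[OF t assms(1)] one_step_last[OF t assms(1)]
      val_commute[of t p 0] val_commute[of t p 1] val_commute[of t p 2]
    by (cases "p \<le> 2"; simp)+
  have "(3 + 4 * t) * (88 + 144 * t) * ((15 + 27 * t) * ?y - (5 * ?x + 10 * ?u))
      = (3 + 4 * t) * (15 + 27 * t) * ((88 + 144 * t) * ?y - (31 * ?x + 57 * ?u))
        + (25 + 117 * t) * ((3 + 4 * t) * ?x - 3 * ?u) + (548 * t + 396 * t ^ 2) * ?u"
    by (simp add: algebra_simps power2_eq_square)
  also have "0 < \<dots>"
    using t u x y by (intro add_nonneg_pos add_nonneg_nonneg mult_nonneg_nonneg mult_pos_pos add_pos_pos) auto
  finally have "0 < (15 + 27 * t) * ?y - (5 * ?x + 10 * ?u)"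
    by (rule zero_less_mult_pos) (use t in \<open>simp add: add_pos_pos\<close>)
  then show ?thesis using True t assms by (simp add: gap_A12'[OF N t])
next
  case False
  let ?u = "val t p (q - 2)" and ?x = "val t p (q - 1)" and ?y = "val t p q"
  have y: "7 * ?x + 5 * ?u < (12 + 27 * t) * ?y"
    using two_step[OF t _ assms(1), of q] False assms val_commute[of t p q] val_commute[of t p "q - 1"]
      val_commute[of t p "q - 2"] by simp
  have x: "?x < ?u"
    using val_decreasing[OF t _ assms(1), of "q - 1"] False assms val_commute[of t p "q - 1"]
      val_commute[of t p "q - 2"] by (simp add: numeral_2_eq_2)
  have "4 * ((3 + 8 * t) * ?y - (2 * ?x + ?u)) = ((12 + 27 * t) * ?y - (7 * ?x + 5 * ?u)) + (?u - ?x) + 5 * t * ?y"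
    by (simp add: algebra_simps)
  also have "0 < \<dots>"
    using x y t val_pos[OF t, of p q] by (intro add_pos_pos mult_pos_pos) simp_all
  finally show ?thesis using False t assms by (simp add: gap_A12'[OF N t])
qed

lemma gap_A0_inner:
  assumes "1 \<le> p" "p \<le> N - 3" "1 \<le> q" "q \<le> N - 3"
  shows "0 \<le> gap N t p q A0"
    "gap N t p q A0 = 0 \<longleftrightarrow> (p, q) \<notin> {(1, 2), (2, 1), (2, 2)}"
proof -
  have "0 \<le> gap N t p q A0 \<and> (gap N t p q A0 = 0 \<longleftrightarrow> (p, q) \<notin> {(1, 2), (2, 1), (2, 2)})"
  proof -
    consider "p = 1" "q = 1" | "p = 2" "q = 1" | "p = 1" "q = 2" | "p = 2" "q = 2"
      | "3 \<le> p" "q = 1" | "p = 1" "3 \<le> q" | "2 \<le> p" "2 \<le> q" "3 \<le> p \<or> 3 \<le> q"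
      using assms by linarith
    then show ?thesis
    proof cases
      case 1
      then show ?thesis using gap_A0[OF N t assms] by simp
    next
      case 2
      then show ?thesis using gap_A0[OF N t assms] both_step_2_1[OF t] t by simp
    next
      case 3
      then show ?thesis
        using gap_A0[OF N t assms] both_step_2_1[OF t] t val_commute[of t 1 2] val_commute[of t 0 2]
          val_commute[of t 0 1] by simp
    next
      case 4
      then show ?thesis
        using gap_A0[OF N t assms] both_step_2_2[OF t] t val_commute[of t 1 2] by simp
    next
      case 5
      then show ?thesis using gap_A0[OF N t assms] val_row_1_mult[OF t 5(1)] by simp
    next
      case 6
      then show ?thesis using gap_A0[OF N t assms] val_column_1_mult[OF t 6(2)] by simp
    next
      case 7
      then show ?thesis using gap_A0[OF N t assms] val_inner_mult[OF t 7] by auto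
    qed
  qed
  then show "0 \<le> gap N t p q A0"
    "gap N t p q A0 = 0 \<longleftrightarrow> (p, q) \<notin> {(1, 2), (2, 1), (2, 2)}" by auto
qed

lemma gap_Null_pos:
  assumes "p \<le> N - 3" "q \<le> N - 3" "p \<noteq> 0 \<or> q \<noteq> 0"
  shows "0 < gap N t p q Null"
  using gap_Null[OF N t assms] val_pos[OF t] by simp

lemma gap_target_Null: "gap N t 0 0 Null = 0"
proof -
  have "val t 0 0 = 1" by (simp add: val_edge edge_val_0[OF t])
  then have "opt_value N t (N, N) = (1 + t) / t"
    using opt_value_coord[OF N, of 0 0 t] by (simp add: coord_0)
  then show ?thesis
    using t by (simp add: gap_def bellman_gap_def expectation_hat_P coord_0 hat_r_def field_simps)
qed

text \<open>Neither staying, nor moving away from the target, nor leaving for the origin with value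
  0 can raise the value, so discounting makes the gap strict.\<close>

lemma gap_Atilde_pos:
  assumes pq: "1 \<le> p" "p \<le> N - 3" "1 \<le> q" "q \<le> N - 3"
  shows "0 < gap N t p q Atilde"
proof -
  have v: "0 < val t p q" "0 < t * val t p q" using t val_pos[OF t, of p q] by simp_all
  consider "p < N - 3" "q < N - 3" | "p = N - 3" "q < N - 3" | "p < N - 3" "q = N - 3" | "p = N - 3" "q = N - 3"
    using pq by linarith
  then show ?thesis
  proof cases
    case 1
    have "gap N t p q Atilde = val t p q"
      using gap_index[OF N t, of p q Atilde "[((p, q), 1)]"] hat_law_Atilde_coord[OF N pq] 1 pq t
      by (simp del: hat_law.simps add: field_simps)
    then show ?thesis using v by simp
  next
    case 2
    have "gap N t p q Atilde = ((1 + t) * val t p q - (1 / 2 * val t p q + 1 / 2 * val t p (q + 1))) / t"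
      using gap_index[OF N t, of p q Atilde "[((p, q), 1/2), ((p, q + 1), 1/2)]"]
        hat_law_Atilde_coord[OF N pq] 2 pq by (simp del: hat_law.simps)
    also have "0 < \<dots>"
    proof (rule divide_pos_pos[OF _ t])
      have "val t p (q + 1) < val t p q"
        using val_decreasing[OF t _ pq(1), of "q + 1"] val_commute[of t p q] val_commute[of t p "q + 1"]
        by simp
      then show "0 < (1 + t) * val t p q - (1 / 2 * val t p q + 1 / 2 * val t p (q + 1))"
        using v by (simp add: algebra_simps)
    qed
    finally show ?thesis .
  next
    case 3
    have "gap N t p q Atilde = ((1 + t) * val t p q - (1 / 2 * val t p q + 1 / 2 * val t (p + 1) q)) / t"
      using gap_index[OF N t, of p q Atilde "[((p, q), 1/2), ((p + 1, q), 1/2)]"]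
        hat_law_Atilde_coord[OF N pq] 3 pq by (simp del: hat_law.simps)
    also have "0 < \<dots>"
    proof (rule divide_pos_pos[OF _ t])
      have "val t (p + 1) q < val t p q"
        using val_decreasing[OF t _ pq(3), of "p + 1"] by simp
      then show "0 < (1 + t) * val t p q - (1 / 2 * val t p q + 1 / 2 * val t (p + 1) q)"
        using v by (simp add: algebra_simps)
    qed
    finally show ?thesis .
  next
    case 4
    have zero: "opt_value N t (0, 0) = 0" by (simp add: opt_value_def)
    have "gap N t p q Atilde = (1 + t) / t * val t p q - 1 / (1 + t) * (1 / 3 * ((1 + t) / t * val t p q))"
      using gap_eq[OF N, of p q t Atilde] hat_law_Atilde_coord[OF N pq] 4 pq zero opt_value_coord[OF N pq(2,4), of t]
      by (simp del: hat_law.simps)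
    also have "\<dots> = (2 + 3 * t) * val t p q / (3 * t)"
      using t by (simp add: divide_simps) (simp add: algebra_simps)
    finally show ?thesis using v t by simp
  qed
qed

end

section \<open>The optimal actions\<close>

text \<open>Writing N as \<open>n + 6\<close> removes truncated subtraction. The five cases are the
  ranges of one coordinate that \<open>A_star\<close> distinguishes.\<close>

lemma coord_cases:
  assumes "p \<le> n + 3"
  shows "p = 0 \<and> coord (n + 6) p = n + 6 \<or> p = 1 \<and> coord (n + 6) p = n + 4
    \<or> p = 2 \<and> coord (n + 6) p = n + 3 \<or> p = 3 \<and> coord (n + 6) p = n + 2
    \<or> 4 \<le> p \<and> 2 \<le> coord (n + 6) p \<and> coord (n + 6) p \<le> n + 1"
  using assms by (auto simp: coord_def)

lemma A_star_coord:
  assumes N: "6 \<le> N" and "p \<le> N - 3" "q \<le> N - 3"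
  shows "A_star N k (coord N p, coord N q) =
    (if p = 0 \<and> q = 0 then {Null}
     else if p = 0 then (if q = 2 \<or> (4 \<le> q \<and> k \<noteq> 1) then {A12} else {A11})
     else if q = 0 then (if p = 2 \<or> (4 \<le> p \<and> k \<noteq> 1) then {A22} else {A21})
     else if p = 1 \<and> q = 2 then {A12}
     else if p = 2 \<and> q = 1 then {A22}
     else if p = 2 \<and> q = 2 then {A12, A22}
     else {A0})"
proof -
  obtain n where n: "N = n + 6" using N by (metis add.commute le_add_diff_inverse)
  have "p \<le> n + 3" "q \<le> n + 3" using assms(2,3) n by auto
  note c = this[THEN coord_cases]
  show ?thesis
    using c unfolding n
    by (elim disjE conjE) simp_all
qed

text \<open>These exclusions match the domains of the gap formulas: a two-step move asks for index
  at least 2, and on an edge only the coordinate away from the target can move.\<close>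

lemma hat_A_coord:
  assumes N: "6 \<le> N" and "p \<le> N - 3" "q \<le> N - 3" and a: "a \<in> hat_A N (coord N p, coord N q)"
  shows "p = 0 \<Longrightarrow> q = 0 \<Longrightarrow> a = Null"
    and "p = 0 \<Longrightarrow> q \<noteq> 0 \<Longrightarrow> a \<in> {A11, A12, Null}"
    and "p \<noteq> 0 \<Longrightarrow> q = 0 \<Longrightarrow> a \<in> {A21, A22, Null}"
    and "p \<noteq> 0 \<Longrightarrow> q = 1 \<Longrightarrow> a \<noteq> A12'"
    and "q = 1 \<Longrightarrow> a \<noteq> A12"
    and "p = 1 \<Longrightarrow> q \<noteq> 0 \<Longrightarrow> a \<noteq> A22'"
    and "p = 1 \<Longrightarrow> a \<noteq> A22"
proof -
  obtain n where n: "N = n + 6" using N by (metis add.commute le_add_diff_inverse)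
  have coarse: "r = 0 \<and> coord (n + 6) r = n + 6 \<or> r = 1 \<and> coord (n + 6) r = n + 4
      \<or> 2 \<le> r \<and> 2 \<le> coord (n + 6) r \<and> coord (n + 6) r \<le> n + 3"
    if "r \<le> n + 3" for r
    using coord_cases[OF that] by auto
  have "p \<le> n + 3" "q \<le> n + 3" using assms(2,3) n by auto
  note c = this[THEN coarse]
  have "(p = 0 \<longrightarrow> q = 0 \<longrightarrow> a = Null) \<and> (p = 0 \<longrightarrow> q \<noteq> 0 \<longrightarrow> a \<in> {A11, A12, Null})
    \<and> (p \<noteq> 0 \<longrightarrow> q = 0 \<longrightarrow> a \<in> {A21, A22, Null}) \<and> (p \<noteq> 0 \<longrightarrow> q = 1 \<longrightarrow> a \<noteq> A12') \<and> (q = 1 \<longrightarrow> a \<noteq> A12)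
    \<and> (p = 1 \<longrightarrow> q \<noteq> 0 \<longrightarrow> a \<noteq> A22') \<and> (p = 1 \<longrightarrow> a \<noteq> A22)"
    using a c unfolding n
    by (elim disjE conjE) (simp_all split: if_splits, auto)
  then show "p = 0 \<Longrightarrow> q = 0 \<Longrightarrow> a = Null"
    and "p = 0 \<Longrightarrow> q \<noteq> 0 \<Longrightarrow> a \<in> {A11, A12, Null}"
    and "p \<noteq> 0 \<Longrightarrow> q = 0 \<Longrightarrow> a \<in> {A21, A22, Null}"
    and "p \<noteq> 0 \<Longrightarrow> q = 1 \<Longrightarrow> a \<noteq> A12'"
    and "q = 1 \<Longrightarrow> a \<noteq> A12"
    and "p = 1 \<Longrightarrow> q \<noteq> 0 \<Longrightarrow> a \<noteq> A22'"
    and "p = 1 \<Longrightarrow> a \<noteq> A22"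
    by blast+
qed

lemma coord_2: "coord N 2 = N - 3"
  by (simp add: coord_def)

lemma A0_in_hat_A:
  assumes N: "6 \<le> N" and "2 \<le> i" "i \<le> N - 2" "2 \<le> j" "j \<le> N - 2"
  shows "A0 \<in> hat_A N (i, j)"
proof -
  obtain n where n: "N = n + 6" using N by (metis add.commute le_add_diff_inverse)
  have "i = 2 \<or> i = n + 4 \<or> 3 \<le> i \<and> i \<le> n + 3" "j = 2 \<or> j = n + 4 \<or> 3 \<le> j \<and> j \<le> n + 3"
    using assms(2-5) n by linarith+
  then show ?thesis
    unfolding n by (elim disjE conjE) simp_all
qed

lemma edge_actions_in_hat_A:
  assumes N: "6 \<le> N" and "2 \<le> j" "j \<le> N - 2"
  shows "A11 \<in> hat_A N (N, j)" "A21 \<in> hat_A N (j, N)"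
    and "j \<noteq> N - 2 \<Longrightarrow> A12 \<in> hat_A N (N, j)" "j \<noteq> N - 2 \<Longrightarrow> A22 \<in> hat_A N (j, N)"
proof -
  obtain n where n: "N = n + 6" using N by (metis add.commute le_add_diff_inverse)
  have "j = n + 4 \<or> 2 \<le> j \<and> j \<le> n + 3" using assms(2,3) n by linarith
  then show "A11 \<in> hat_A N (N, j)" "A21 \<in> hat_A N (j, N)"
    and "j \<noteq> N - 2 \<Longrightarrow> A12 \<in> hat_A N (N, j)" "j \<noteq> N - 2 \<Longrightarrow> A22 \<in> hat_A N (j, N)"
    unfolding n by (elim disjE conjE; simp)+
qed

text \<open>Together with \<open>gap_sign\<close>, this gives every state other than the origin an
  available action with gap zero, so that the candidate value is attained.\<close>

lemma A_star_available:
  assumes N: "6 \<le> N" and pq: "p \<le> N - 3" "q \<le> N - 3"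
  shows "\<exists>a\<in>A_star N k (coord N p, coord N q). a \<in> hat_A N (coord N p, coord N q)"
proof -
  have inner: "2 \<le> coord N r \<and> coord N r \<le> N - 2 \<and> (coord N r = N - 2 \<longrightarrow> r = 1)"
    if "r \<noteq> 0" "r \<le> N - 3" for r
    using that N by (auto simp: coord_def)
  have corner: "A12 \<in> hat_A N (N - 2, N - 3)" "A22 \<in> hat_A N (N - 3, N - 2)" "A12 \<in> hat_A N (N - 3, N - 3)"
  proof -
    obtain n where n: "N = n + 6" using N by (metis add.commute le_add_diff_inverse)
    show "A12 \<in> hat_A N (N - 2, N - 3)" "A22 \<in> hat_A N (N - 3, N - 2)" "A12 \<in> hat_A N (N - 3, N - 3)"
      unfolding n by simp_all
  qed
  consider "p = 0" "q = 0" | "p = 0" "q \<noteq> 0" | "p \<noteq> 0" "q = 0"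
    | "p = 1" "q = 2" | "p = 2" "q = 1" | "p = 2" "q = 2"
    | "p \<noteq> 0" "q \<noteq> 0" "\<not> (p = 1 \<and> q = 2)" "\<not> (p = 2 \<and> q = 1)" "\<not> (p = 2 \<and> q = 2)"
    by blast
  then show ?thesis
  proof cases
    case 1
    then have "Null \<in> A_star N k (coord N p, coord N q)" "Null \<in> hat_A N (coord N p, coord N q)"
      unfolding A_star_coord[OF assms] by (simp_all add: coord_0)
    then show ?thesis by blast
  next
    case 2
    have "A11 \<in> hat_A N (coord N p, coord N q)" "q \<noteq> 1 \<Longrightarrow> A12 \<in> hat_A N (coord N p, coord N q)"
      using edge_actions_in_hat_A[OF N, of "coord N q"] inner[OF 2(2) pq(2)] unfolding 2(1) coord_0
      by blast+
    moreover have "A11 \<in> A_star N k (coord N p, coord N q) \<or> q \<noteq> 1 \<and> A12 \<in> A_star N k (coord N p, coord N q)"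
      unfolding A_star_coord[OF assms] using 2 by simp
    ultimately show ?thesis by blast
  next
    case 3
    have "A21 \<in> hat_A N (coord N p, coord N q)" "p \<noteq> 1 \<Longrightarrow> A22 \<in> hat_A N (coord N p, coord N q)"
      using edge_actions_in_hat_A[OF N, of "coord N p"] inner[OF 3(1) pq(1)] unfolding 3(2) coord_0
      by blast+
    moreover have "A21 \<in> A_star N k (coord N p, coord N q) \<or> p \<noteq> 1 \<and> A22 \<in> A_star N k (coord N p, coord N q)"
      unfolding A_star_coord[OF assms] using 3 by simp
    ultimately show ?thesis by blast
  next
    case 4
    have "A12 \<in> A_star N k (coord N p, coord N q)"
      unfolding A_star_coord[OF assms] using 4 by simp
    then show ?thesis using corner(1) 4 coord_1 coord_2 by metis
  next
    case 5
    have "A22 \<in> A_star N k (coord N p, coord N q)"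
      unfolding A_star_coord[OF assms] using 5 by simp
    then show ?thesis using corner(2) 5 coord_1 coord_2 by metis
  next
    case 6
    have "A12 \<in> A_star N k (coord N p, coord N q)"
      unfolding A_star_coord[OF assms] using 6 by simp
    then show ?thesis using corner(3) 6 coord_2 by metis
  next
    case 7
    have "A0 \<in> hat_A N (coord N p, coord N q)"
      using A0_in_hat_A[OF N] inner[OF 7(1) pq(1)] inner[OF 7(2) pq(2)] by blast
    moreover have "A0 \<in> A_star N k (coord N p, coord N q)"
      unfolding A_star_coord[OF assms] using 7 by auto
    ultimately show ?thesis by blast
  qed
qed

definition optimal_actions :: "nat \<Rightarrow> real \<Rightarrow> state \<Rightarrow> action set" where
  "optimal_actions N lam s =
    (if lambda_c < lam then A_star N 1 s
     else if lam = lambda_c then A_star N 1 s \<union> A_star N 2 s else A_star N 2 s)"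

lemma optimal_actions_coord:
  assumes N: "6 \<le> N" and pq: "p \<le> N - 3" "q \<le> N - 3" and t: "0 < t"
  shows "optimal_actions N (1 / (1 + t)) (coord N p, coord N q) =
    (if p = 0 \<and> q = 0 then {Null}
     else if p = 0 then {a. a = A11 \<and> (q = 1 \<or> q = 3 \<or> (4 \<le> q \<and> t \<le> 2 / 15))
       \<or> a = A12 \<and> (q = 2 \<or> (4 \<le> q \<and> 2 / 15 \<le> t))}
     else if q = 0 then {a. a = A21 \<and> (p = 1 \<or> p = 3 \<or> (4 \<le> p \<and> t \<le> 2 / 15))
       \<or> a = A22 \<and> (p = 2 \<or> (4 \<le> p \<and> 2 / 15 \<le> t))}
     else if p = 1 \<and> q = 2 then {A12}
     else if p = 2 \<and> q = 1 then {A22}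
     else if p = 2 \<and> q = 2 then {A12, A22}
     else {A0})"
proof -
  have lam: "lambda_c < 1 / (1 + t) \<longleftrightarrow> t < 2 / 15" "1 / (1 + t) = lambda_c \<longleftrightarrow> t = 2 / 15"
    using t by (auto simp: lambda_c_def field_simps)
  have c: "r = 0 \<or> r = 1 \<or> r = 2 \<or> r = 3 \<or> 4 \<le> r" for r :: nat by linarith
  show ?thesis
    unfolding optimal_actions_def A_star_coord[OF N pq] lam
    using c[of p] c[of q] by (elim disjE) (auto split: if_splits)
qed

lemma gap_sign:
  assumes N: "6 \<le> N" and pq: "p \<le> N - 3" "q \<le> N - 3" and t: "0 < t"
    and a: "a \<in> hat_A N (coord N p, coord N q)"
  shows "0 \<le> gap N t p q a \<and>
    (gap N t p q a = 0 \<longleftrightarrow> a \<in> optimal_actions N (1 / (1 + t)) (coord N p, coord N q))"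
proof -
  note avail = hat_A_coord[OF N pq a]
  consider "p = 0" "q = 0" | "p = 0" "q \<noteq> 0" | "p \<noteq> 0" "q = 0" | "p \<noteq> 0" "q \<noteq> 0" by blast
  then show ?thesis
  proof cases
    case 1
    then show ?thesis
      using avail(1) gap_target_Null[OF N t] unfolding optimal_actions_coord[OF N pq t] by simp
  next
    case 2
    then have q: "1 \<le> q" by simp
    have q2: "2 \<le> q" if "a = A12"
      using avail(5) that q by (cases "q = 1") auto
    have target: "optimal_actions N (1 / (1 + t)) (coord N p, coord N q) =
        {a. a = A11 \<and> (q = 1 \<or> q = 3 \<or> (4 \<le> q \<and> t \<le> 2 / 15))
          \<or> a = A12 \<and> (q = 2 \<or> (4 \<le> q \<and> 2 / 15 \<le> t))}"
      unfolding optimal_actions_coord[OF N pq t] using 2 by simp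
    consider "a = A11" | "a = A12" | "a = Null" using avail(2) 2 by blast
    then show ?thesis
    proof cases
      case 1
      then show ?thesis
        using gap_A11_edge[OF N t q pq(2)] 2 unfolding target by simp
    next
      case 2
      then show ?thesis
        using gap_A12_edge[OF N t q2 pq(2)] \<open>p = 0\<close> unfolding target by simp
    next
      case 3
      then show ?thesis using gap_Null_pos[OF N t pq] 2 unfolding target by simp
    qed
  next
    case 3
    then have p: "1 \<le> p" by simp
    have p2: "2 \<le> p" if "a = A22"
      using avail(7) that p by (cases "p = 1") auto
    have target: "optimal_actions N (1 / (1 + t)) (coord N p, coord N q) =
        {a. a = A21 \<and> (p = 1 \<or> p = 3 \<or> (4 \<le> p \<and> t \<le> 2 / 15))
          \<or> a = A22 \<and> (p = 2 \<or> (4 \<le> p \<and> 2 / 15 \<le> t))}"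
      unfolding optimal_actions_coord[OF N pq t] using 3 by simp
    consider "a = A21" | "a = A22" | "a = Null" using avail(3) 3 by blast
    then show ?thesis
    proof cases
      case 1
      then show ?thesis
        using gap_A11_edge[OF N t p pq(1)] 3 unfolding target by (simp add: gap_A2)
    next
      case 2
      then show ?thesis
        using gap_A12_edge[OF N t p2 pq(1)] \<open>q = 0\<close> unfolding target by (simp add: gap_A2)
    next
      case 3
      then show ?thesis using gap_Null_pos[OF N t pq] p unfolding target by simp
    qed
  next
    case 4
    then have p: "1 \<le> p" and q: "1 \<le> q" by auto
    have q2: "2 \<le> q" if "a = A12 \<or> a = A12'"
      using avail(4,5) that 4 q by (cases "q = 1") auto
    have p2: "2 \<le> p" if "a = A22 \<or> a = A22'"
      using avail(6,7) that 4 p by (cases "p = 1") auto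
    show ?thesis
    proof (cases a)
      case A11
      then show ?thesis
        using gap_A11_inner_pos[OF N t p pq(1) q pq(2)] 4 unfolding optimal_actions_coord[OF N pq t] by auto
    next
      case A11'
      then show ?thesis
        using gap_A11_inner_pos[OF N t p pq(1) q pq(2)] 4 unfolding optimal_actions_coord[OF N pq t] by auto
    next
      case A21
      then show ?thesis
        using gap_A11_inner_pos[OF N t q pq(2) p pq(1)] 4
        unfolding optimal_actions_coord[OF N pq t] by (auto simp: gap_A2)
    next
      case A21'
      then show ?thesis
        using gap_A11_inner_pos[OF N t q pq(2) p pq(1)] 4
        unfolding optimal_actions_coord[OF N pq t] by (auto simp: gap_A2)
    next
      case A12
      then show ?thesis
        using gap_A12_inner[OF N t p pq(1) q2 pq(2)] q2 4
        unfolding optimal_actions_coord[OF N pq t] by auto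
    next
      case A22
      then show ?thesis
        using gap_A12_inner[OF N t q pq(2) p2 pq(1)] p2 4
        unfolding optimal_actions_coord[OF N pq t] by (auto simp: gap_A2)
    next
      case A12'
      then show ?thesis
        using gap_A12'_inner_pos[OF N t p pq(1) q2 pq(2)] 4
        unfolding optimal_actions_coord[OF N pq t] by auto
    next
      case A22'
      then show ?thesis
        using gap_A12'_inner_pos[OF N t q pq(2) p2 pq(1)] 4
        unfolding optimal_actions_coord[OF N pq t] by (auto simp: gap_A2)
    next
      case A0
      then show ?thesis
        using gap_A0_inner[OF N t p pq(1) q pq(2)] 4
        unfolding optimal_actions_coord[OF N pq t] by auto
    next
      case Atilde
      then show ?thesis
        using gap_Atilde_pos[OF N t p pq(1) q pq(2)] 4 unfolding optimal_actions_coord[OF N pq t] by auto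
    next
      case Null
      then show ?thesis
        using gap_Null_pos[OF N t pq] 4 unfolding optimal_actions_coord[OF N pq t] by auto
    qed
  qed
qed

text \<open>Proved for all actions, available or not, since \<open>hat_law\<close> is total. The
  point to watch is the missing coordinate \<open>N - 1\<close>: every law that moves forward from
  \<open>N - 2\<close> jumps to \<open>N\<close>.\<close>

lemma hat_law_closed:
  assumes N: "6 \<le> N" and s: "s \<in> hat_S N"
  shows "fst ` set (hat_law N s a) \<subseteq> hat_S N"
proof -
  obtain n where n: "N = n + 6" using N by (metis add.commute le_add_diff_inverse)
  obtain i j where ij: "s = (i, j)" by (cases s)
  let ?C = "{2..n + 4} \<union> {n + 6}"
  have hat_S: "hat_S N = ?C \<times> ?C \<union> {(0, 0)}"
    unfolding n hat_S_def by auto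
  show ?thesis
  proof (cases "i = 0 \<and> j = 0")
    case True
    have "hat_law (n + 6) (0, 0) a = [((0, 0), 1)]"
      by (cases a) (simp_all add: move_fst_def move_snd_def law_1_def law_2_def law_1'_def law_2'_def)
    then show ?thesis using True s unfolding ij n by (simp del: hat_law.simps)
  next
    case False
    then have i: "i \<in> ?C" and j: "j \<in> ?C" using s unfolding ij hat_S by auto
    have moves: "fst ` set (law_1 N k) \<subseteq> ?C" "fst ` set (law_2 N k) \<subseteq> ?C"
      "fst ` set (law_1' N k) \<subseteq> ?C" "fst ` set (law_2' N k) \<subseteq> ?C" if k: "k \<in> ?C" for k
    proof -
      have "2 \<le> k \<and> k \<le> n + 2 \<or> k = n + 3 \<or> k = n + 4 \<or> k = n + 6"
        using k by auto
      then show "fst ` set (law_1 N k) \<subseteq> ?C" "fst ` set (law_2 N k) \<subseteq> ?C"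
        "fst ` set (law_1' N k) \<subseteq> ?C" "fst ` set (law_2' N k) \<subseteq> ?C"
        unfolding n law_1_def law_2_def law_1'_def law_2'_def by (elim disjE conjE; simp)+
    qed
    have snd_move: "fst ` set (move_snd i xs) \<subseteq> hat_S N" if "fst ` set xs \<subseteq> ?C" for xs
      using that i unfolding hat_S by (force simp: move_snd_def)
    have fst_move: "fst ` set (move_fst j xs) \<subseteq> hat_S N" if "fst ` set xs \<subseteq> ?C" for xs
      using that j unfolding hat_S by (force simp: move_fst_def)
    have both: "fst ` set (hat_law N (i, j) A0) \<subseteq> ?C \<times> ?C"
    proof -
      have "2 \<le> i \<and> i \<le> n + 3 \<or> i = n + 4 \<or> i = n + 6" "2 \<le> j \<and> j \<le> n + 3 \<or> j = n + 4 \<or> j = n + 6"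
        using i j by auto
      then show ?thesis unfolding n by (elim disjE conjE) simp_all
    qed
    have tilde: "fst ` set (hat_law N (i, j) Atilde) \<subseteq> ?C \<times> ?C \<union> {(0, 0)}"
    proof -
      have "i = 2 \<or> 3 \<le> i \<and> i \<le> n + 4 \<or> i = n + 6" "j = 2 \<or> 3 \<le> j \<and> j \<le> n + 4 \<or> j = n + 6"
        using i j by auto
      then show ?thesis unfolding n by (elim disjE conjE) auto
    qed
    show ?thesis
    proof (cases a)
      case A0
      then show ?thesis using both unfolding ij hat_S by blast
    next
      case Atilde
      then show ?thesis using tilde unfolding ij hat_S by blast
    next
      case Null
      then show ?thesis using s unfolding ij by simp
    qed (simp_all only: ij hat_law.simps
      snd_move[OF moves(1)[OF j]] snd_move[OF moves(2)[OF j]] snd_move[OF moves(3)[OF j]] snd_move[OF moves(4)[OF j]]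
      fst_move[OF moves(1)[OF i]] fst_move[OF moves(2)[OF i]] fst_move[OF moves(3)[OF i]] fst_move[OF moves(4)[OF i]])
  qed
qed

theorem theorem3p1:
  fixes N :: nat and lam :: real and d :: "state \<Rightarrow> action"
  assumes "N \<ge> 6"
    and "0 < lam" and "lam < 1"
    and "decision_rule (hat_S N) (hat_A N) d"
  shows "optimal_policy (hat_S N) (hat_A N) (hat_P N) (hat_r N) lam d \<longleftrightarrow>
    (\<forall>(i, j) \<in> hat_S N - {(0, 0)}.
       d (i, j) \<in> (if lambda_c < lam then A_star N 1 (i, j)
                   else if lam = lambda_c then A_star N 1 (i, j) \<union> A_star N 2 (i, j)
                   else A_star N 2 (i, j)))"
proof -
  define t where "t = (1 - lam) / lam"
  have t: "0 < t" and lam: "lam = 1 / (1 + t)"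
    using assms(2,3) by (auto simp: t_def field_simps)
  let ?gap = "bellman_gap (hat_P N) (hat_r N) lam (opt_value N t)"
  have finite: "finite (hat_S N)"
    by (rule finite_subset[of _ "{..N} \<times> {..N}"]) (auto simp: hat_S_def)
  have bounded: "\<bar>opt_value N t s\<bar> \<le> (\<Sum>s\<in>hat_S N. \<bar>opt_value N t s\<bar>)" for s
  proof (cases "s \<in> hat_S N")
    case True
    then show ?thesis using finite by (intro member_le_sum) auto
  next
    case False
    then show ?thesis by (simp add: opt_value_def sum_nonneg)
  qed
  have closed: "set_pmf (hat_P N s a) \<subseteq> hat_S N" if "s \<in> hat_S N" for s a
    using set_pmf_of_list[OF pmf_of_list_wf_hat_law, of N s a] hat_law_closed[OF assms(1) that, of a]
    by (auto simp: hat_P_def)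
  have origin: "?gap (0, 0) Null = 0"
    using assms(1) by (simp add: bellman_gap_def expectation_hat_P opt_value_def hat_r_def)
  have sign: "0 \<le> ?gap s a \<and> (?gap s a = 0 \<longleftrightarrow> a \<in> optimal_actions N lam s)"
    if "s \<in> hat_S N - {(0, 0)}" "a \<in> hat_A N s" for s a
    using that gap_sign[OF assms(1) _ _ t] unfolding hat_S_eq_coord[OF assms(1)] lam gap_def
    by auto
  have greedy: "\<exists>a\<in>hat_A N s. ?gap s a = 0" if "s \<in> hat_S N" for s
  proof (cases "s = (0, 0)")
    case True
    then show ?thesis using origin by simp
  next
    case False
    then have "s \<in> hat_S N - {(0, 0)}" using that by simp
    then obtain p q where pq: "s = (coord N p, coord N q)" "p \<le> N - 3" "q \<le> N - 3"
      unfolding hat_S_eq_coord[OF assms(1)] by auto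
    have "\<exists>a\<in>A_star N k s. a \<in> hat_A N s" for k
      using A_star_available[OF assms(1) pq(2,3), of k] unfolding pq(1) .
    then obtain a where "a \<in> hat_A N s" "a \<in> optimal_actions N lam s"
      unfolding optimal_actions_def by (metis UnI1)
    then show ?thesis using sign[of s a] that False by auto
  qed
  have "optimal_policy (hat_S N) (hat_A N) (hat_P N) (hat_r N) lam d \<longleftrightarrow> (\<forall>s\<in>hat_S N. ?gap s (d s) = 0)"
  proof (rule optimal_policy_iff_bellman_gap_eq_0[OF _ assms(3) _ bounded closed _ greedy assms(4)])
    show "\<bar>hat_r N s a\<bar> \<le> 1" for s a by (simp add: hat_r_def)
    show "0 \<le> ?gap s a" if "s \<in> hat_S N" "a \<in> hat_A N s" for s a
      using that sign[of s a] origin by (cases "s = (0, 0)") auto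
  qed (use assms(2) in auto)
  also have "\<dots> \<longleftrightarrow> (\<forall>s\<in>hat_S N - {(0, 0)}. d s \<in> optimal_actions N lam s)"
  proof -
    have d: "d s \<in> hat_A N s" if "s \<in> hat_S N" for s
      using assms(4) that by (simp add: decision_rule_def)
    have "?gap (0, 0) (d (0, 0)) = 0"
      using d[of "(0, 0)"] origin by (simp add: hat_S_def)
    then show ?thesis using sign d by blast
  qed
  finally show ?thesis by (simp only: optimal_actions_def case_prod_unfold prod.collapse)
qed

end
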